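(* Let $n\in\mathbb{N}$, $n\ge2$, and let $\mathcal{P}$ be the family of all polytopes $P\in\mathcal{P}([n^2]\times[n^4])$ in $\mathbb{R}^2$ with exactly $n$ vertices. Then one has $$\max_{P\in\mathcal{P}}\operatorname{sxc}(P)\ge\frac14\sqrt[4]{n}\qquad\text{and}\qquad\max_{P\in\mathcal{P}}\operatorname{xc}(P)\ge\frac1{15}\sqrt n.$$
   Context: $\mathbb{N}=\{1,2,3,\ldots\}$ and $[N]=\{1,\ldots,N\}$. For a finite set $X\subseteq\mathbb{R}^d$, $\mathcal{P}(X)=\{\operatorname{conv}(X'):X'\subseteq X\}$. $\mathcal{S}^k$ is the space of real symmetric $k\times k$ matrices and $\mathcal{S}^k_+$ the cone of positive semidefinite matrices in it. A set $P\subseteq\mathbb{R}^d$ has an extended formulation with an LMI of size $k$ if there exist $q\in\mathbb{N}$ and affine maps $\varphi:\mathbb{R}^q\to\mathbb{R}^d$ and $M:\mathbb{R}^q\to\mathcal{S}^k$ such that $P=\varphi(Q)$ with $Q=\{x\in\mathbb{R}^q:M(x)\in\mathcal{S}^k_+\}$. If moreover $M(x)$ is a diagonal matrix for all $x$ and $k=\ell$ (so that $Q$ is defined by $\ell$ linear inequalities), it is an extended formulation with $\ell$ linear inequalities. For a polytope $P$, the semidefinite extension complexity $\operatorname{sxc}(P)$ is the smallest $k$ such that $P$ has an extended formulation with an LMI of size $k$; the linear extension complexity $\operatorname{xc}(P)$ is the smallest $\ell$ such that $P$ has an extended formulation with $\ell$ linear inequalities. If $P$ is empty or a single point, $\operatorname{sxc}(P)=\operatorname{xc}(P)=0$.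 *)

theory Defs
  imports "HOL-Analysis.Analysis" "Jordan_Normal_Form.Matrix"
begin

text \<open>
  The number \<open>q\<close> of variables and the size \<open>k\<close> of a matrix inequality are quantified inside the
  definitions below.  Therefore \<open>\<real>\<^sup>q\<close> is the carrier \<^term>\<open>carrier_vec q\<close> and matrices live in
  \<^term>\<open>carrier_mat k k\<close>, whereas polytopes live in a type of class \<^class>\<open>euclidean_space\<close>.
\<close>

definition polytopes_on :: "'a::euclidean_space set \<Rightarrow> 'a set set" where
  "polytopes_on X = {convex hull X' |X'. X' \<subseteq> X}"

definition vertices :: "'a::euclidean_space set \<Rightarrow> 'a set" where
  "vertices P = {v. v extreme_point_of P}"

definition affine_map_on :: "nat \<Rightarrow> (real Matrix.vec \<Rightarrow> 'b::real_vector) \<Rightarrow> bool" where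
  "affine_map_on q f \<longleftrightarrow>
    (\<exists>L c. (\<forall>x\<in>carrier_vec q. \<forall>y\<in>carrier_vec q. L (x + y) = L x + L y) \<and>
           (\<forall>a. \<forall>x\<in>carrier_vec q. L (a \<cdot>\<^sub>v x) = a *\<^sub>R L x) \<and>
           (\<forall>x\<in>carrier_vec q. f x = L x + c))"

definition sym_mats :: "nat \<Rightarrow> real Matrix.mat set" where
  "sym_mats k = {A \<in> carrier_mat k k. transpose_mat A = A}"

definition psd_mats :: "nat \<Rightarrow> real Matrix.mat set" where
  "psd_mats k = {A \<in> sym_mats k. \<forall>v\<in>carrier_vec k. 0 \<le> scalar_prod v (A *\<^sub>v v)}"

text \<open>
  The type of matrices is not a vector space (the dimensions vary), so affinity of a matrix-valued
  map is affinity of each of its entries.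
\<close>

definition affine_sym_map_on :: "nat \<Rightarrow> nat \<Rightarrow> (real Matrix.vec \<Rightarrow> real Matrix.mat) \<Rightarrow> bool" where
  "affine_sym_map_on q k M \<longleftrightarrow>
    (\<forall>x\<in>carrier_vec q. M x \<in> sym_mats k) \<and>
    (\<forall>i<k. \<forall>j<k. affine_map_on q (\<lambda>x. M x $$ (i, j)))"

definition ext_formulation ::
  "nat \<Rightarrow> nat \<Rightarrow> (real Matrix.vec \<Rightarrow> 'a::euclidean_space) \<Rightarrow> (real Matrix.vec \<Rightarrow> real Matrix.mat)
    \<Rightarrow> 'a set \<Rightarrow> bool" where
  "ext_formulation q k \<phi> M P \<longleftrightarrow>
    1 \<le> q \<and> affine_map_on q \<phi> \<and> affine_sym_map_on q k M \<and>
    P = \<phi> ` {x \<in> carrier_vec q. M x \<in> psd_mats k}"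

definition has_lmi_formulation :: "'a::euclidean_space set \<Rightarrow> nat \<Rightarrow> bool" where
  "has_lmi_formulation P k \<longleftrightarrow> (\<exists>q \<phi> M. ext_formulation q k \<phi> M P)"

definition has_linear_formulation :: "'a::euclidean_space set \<Rightarrow> nat \<Rightarrow> bool" where
  "has_linear_formulation P l \<longleftrightarrow>
    (\<exists>q \<phi> M. ext_formulation q l \<phi> M P \<and> (\<forall>x\<in>carrier_vec q. diagonal_mat (M x)))"

lemma polytope_has_formulations:
  fixes P :: "'a::euclidean_space set"
  assumes "polytope P" and "P \<noteq> {}"
  shows "\<exists>l. has_linear_formulation P l" and "\<exists>k. has_lmi_formulation P k"
proof -
  obtain V where V: "finite V" "P = convex hull V"
    using assms(1) by (auto simp: polytope_def)
  with assms(2) have "V \<noteq> {}" by auto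
  define m where "m = card V"
  obtain v where v: "bij_betw v {..<m} V"
    using ex_bij_betw_nat_finite[OF V(1)] by (auto simp: m_def atLeast0LessThan)
  have "1 \<le> m"
    using V(1) \<open>V \<noteq> {}\<close> by (simp add: m_def Suc_le_eq card_gt_0_iff)
  define s :: "real Matrix.vec \<Rightarrow> real" where "s x = (\<Sum>i<m. vec_index x i)" for x
  define \<phi> :: "real Matrix.vec \<Rightarrow> 'a" where "\<phi> x = (\<Sum>i<m. vec_index x i *\<^sub>R v i)" for x
  define g where "g i x = (if i < m then vec_index x i else if i = m then s x - 1 else 1 - s x)"
    for i :: nat and x
  define M where "M x = Matrix.mat (m + 2) (m + 2) (\<lambda>(i, j). if i = j then g i x else 0)" for x
  have s_affine: "s (x + y) = s x + s y" "s (a \<cdot>\<^sub>v x) = a * s x"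
    if "x \<in> carrier_vec m" "y \<in> carrier_vec m" for x y a
    using that by (auto simp: s_def sum.distrib sum_distrib_left)
  have \<phi>: "affine_map_on m \<phi>"
    unfolding affine_map_on_def
    by (rule exI[of _ \<phi>], rule exI[of _ 0])
      (auto simp: \<phi>_def sum.distrib scaleR_add_left scaleR_right.sum)
  have g: "affine_map_on m (g i)" for i
    unfolding affine_map_on_def
    by (rule exI[of _ "\<lambda>x. if i < m then vec_index x i else if i = m then s x else - s x"],
        rule exI[of _ "if i < m then 0 else if i = m then - 1 else 1"])
      (auto simp: g_def s_affine)
  have zero: "affine_map_on m (\<lambda>x. 0 :: real)"
    unfolding affine_map_on_def by (rule exI[of _ "\<lambda>x. 0"], rule exI[of _ 0]) auto
  have sym: "M x \<in> sym_mats (m + 2)" for x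
    unfolding sym_mats_def M_def by auto
  have M: "affine_sym_map_on m (m + 2) M"
    unfolding affine_sym_map_on_def
  proof (intro conjI allI impI ballI sym)
    fix i j assume "i < m + 2" "j < m + 2"
    then have "(\<lambda>x. M x $$ (i, j)) = (if i = j then g i else (\<lambda>x. 0))"
      by (auto simp: M_def)
    then show "affine_map_on m (\<lambda>x. M x $$ (i, j))" using g zero by simp
  qed
  have diag: "diagonal_mat (M x)" for x
    unfolding diagonal_mat_def M_def by auto
  have form: "scalar_prod w (M x *\<^sub>v w) = (\<Sum>i<m+2. g i x * (vec_index w i)\<^sup>2)"
    if w: "w \<in> carrier_vec (m + 2)" for x w
  proof -
    have "vec_index (M x *\<^sub>v w) i = g i x * vec_index w i" if "i < m + 2" for i
    proof -
      have "vec_index (M x *\<^sub>v w) i = (\<Sum>j<m+2. (if i = j then g i x else 0) * vec_index w j)"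
        using w that unfolding M_def mult_mat_vec_def scalar_prod_def
        by (auto simp: atLeast0LessThan intro!: sum.cong)
      also have "\<dots> = (\<Sum>j<m+2. if j = i then g i x * vec_index w j else 0)"
        by (rule sum.cong) auto
      also have "\<dots> = g i x * vec_index w i" using that by (subst sum.delta) auto
      finally show ?thesis .
    qed
    then show ?thesis
      unfolding scalar_prod_def
      by (auto simp: M_def atLeast0LessThan power2_eq_square mult_ac intro!: sum.cong)
  qed
  have psd: "M x \<in> psd_mats (m + 2) \<longleftrightarrow> (\<forall>i<m+2. 0 \<le> g i x)" for x
  proof
    assume x: "M x \<in> psd_mats (m + 2)"
    show "\<forall>i<m+2. 0 \<le> g i x"
    proof (intro allI impI)
      fix i assume i: "i < m + 2"
      have "0 \<le> (\<Sum>j<m+2. g j x * (vec_index (unit_vec (m + 2) i) j)\<^sup>2)"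
        using x unfolding psd_mats_def by (simp only: mem_Collect_eq flip: form[OF unit_vec_carrier]) simp
      also have "\<dots> = (\<Sum>j<m+2. if j = i then g j x else 0)"
        using i by (intro sum.cong) auto
      also have "\<dots> = g i x" using i by (subst sum.delta) auto
      finally show "0 \<le> g i x" .
    qed
  next
    assume "\<forall>i<m+2. 0 \<le> g i x"
    then show "M x \<in> psd_mats (m + 2)"
      unfolding psd_mats_def using sym by (auto simp: form simp del: sum.lessThan_Suc intro!: sum_nonneg)
  qed
  have feas: "(\<forall>i<m+2. 0 \<le> g i x) \<longleftrightarrow> (\<forall>i<m. 0 \<le> vec_index x i) \<and> s x = 1" for x
  proof
    assume a: "\<forall>i<m+2. 0 \<le> g i x"
    have "0 \<le> vec_index x i" if "i < m" for i using a[rule_format, of i] that by (simp add: g_def)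
    moreover have "s x = 1"
      using a[rule_format, of m] a[rule_format, of "m + 1"] by (simp add: g_def)
    ultimately show "(\<forall>i<m. 0 \<le> vec_index x i) \<and> s x = 1" by blast
  qed (auto simp: g_def)
  have reindex: "(\<Sum>x\<in>V. f x) = (\<Sum>i<m. f (v i))" for f :: "'a \<Rightarrow> 'b::comm_monoid_add"
    using sum.reindex_bij_betw[OF v, of f] by simp
  have "P = \<phi> ` {x \<in> carrier_vec m. M x \<in> psd_mats (m + 2)}" (is "_ = \<phi> ` ?Q")
  proof (intro equalityI subsetI)
    fix y assume "y \<in> P"
    then obtain u where u: "\<forall>x\<in>V. 0 \<le> u x" "sum u V = 1" "(\<Sum>x\<in>V. u x *\<^sub>R x) = y"
      unfolding V(2) convex_hull_finite[OF V(1)] by auto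
    define x where "x = Matrix.vec m (\<lambda>i. u (v i))"
    have "s x = 1"
      using u(2) reindex[of u] by (simp add: s_def x_def)
    moreover have "\<forall>i<m. 0 \<le> vec_index x i"
      using u(1) v by (auto simp: x_def bij_betw_def)
    moreover have "x \<in> carrier_vec m" by (simp add: x_def)
    moreover have "\<phi> x = y"
      using u(3) reindex[of "\<lambda>x. u x *\<^sub>R x"] by (simp add: \<phi>_def x_def)
    ultimately show "y \<in> \<phi> ` ?Q" using psd feas by blast
  next
    fix y assume "y \<in> \<phi> ` ?Q"
    then obtain x where x: "y = \<phi> x" "\<forall>i<m. 0 \<le> vec_index x i" "s x = 1"
      using psd feas by blast
    have "v i \<in> convex hull V" if "i < m" for i
      using v that by (auto simp: bij_betw_def intro: hull_inc)
    then show "y \<in> P"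
      unfolding x(1) \<phi>_def V(2) using x(2,3)
      by (intro convex_sum) (auto simp: s_def)
  qed
  then have "ext_formulation m (m + 2) \<phi> M P"
    unfolding ext_formulation_def using \<open>1 \<le> m\<close> \<phi> M by blast
  then show "\<exists>l. has_linear_formulation P l" and "\<exists>k. has_lmi_formulation P k"
    unfolding has_linear_formulation_def has_lmi_formulation_def using diag by blast+
qed

text \<open>
  The least elements below exist for every nonempty polytope by \<open>polytope_has_formulations\<close>.
\<close>

definition sxc :: "'a::euclidean_space set \<Rightarrow> nat" where
  "sxc P = (if P = {} \<or> (\<exists>p. P = {p}) then 0 else (LEAST k. has_lmi_formulation P k))"

definition xc :: "'a::euclidean_space set \<Rightarrow> nat" where
  "xc P = (if P = {} \<or> (\<exists>p. P = {p}) then 0 else (LEAST l. has_linear_formulation P l))"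

definition grid :: "nat \<Rightarrow> nat \<Rightarrow> (real^2) set" where
  "grid a b = {vector [real i, real j] |i j. i \<in> {1..a} \<and> j \<in> {1..b}}"

definition grid_polygons :: "nat \<Rightarrow> (real^2) set set" where
  "grid_polygons n = {P \<in> polytopes_on (grid (n^2) (n^4)). card (vertices P) = n}"

text \<open>The family has a maximum for every integer parameter:\<close>

lemma finite_grid_polygons: "finite (grid_polygons n)"
proof -
  have "grid a b = (\<lambda>(i, j). vector [real i, real j]) ` ({1..a} \<times> {1..b})" for a b
    unfolding grid_def by fastforce
  then have "finite (grid a b)" for a b
    by simp
  moreover have "polytopes_on X = (\<lambda>X'. convex hull X') ` Pow X" for X :: "(real^2) set"
    unfolding polytopes_on_def by auto
  ultimately show ?thesis
    unfolding grid_polygons_def by simp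
qed

lemma grid_polygons_nonempty: "grid_polygons n \<noteq> {}"
proof -
  define p :: "nat \<Rightarrow> real^2" where "p i = vector [real i, real (i\<^sup>2)]" for i
  define S where "S = p ` {1..n}"
  have inj: "inj_on p {1..n}"
  proof (rule inj_onI)
    fix i j assume "p i = p j"
    then have "p i $ 1 = p j $ 1" by simp
    then show "i = j" by (simp add: p_def)
  qed
  have indep: "a \<notin> convex hull (S - {a})" if "a \<in> S" for a
  proof
    assume a: "a \<in> convex hull (S - {a})"
    obtain j where j: "a = p j" using \<open>a \<in> S\<close> by (auto simp: S_def)
    define w :: "real^2" where "w = vector [- 2 * real j, 1]"
    have w: "inner w (p i) = (real i - real j)\<^sup>2 - (real j)\<^sup>2" for i
      by (simp add: w_def p_def inner_vec_def sum_2 power2_eq_square algebra_simps)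
    have "S - {a} \<subseteq> {x. inner w x \<ge> 1 - (real j)\<^sup>2}"
    proof
      fix x assume "x \<in> S - {a}"
      then obtain i where i: "x = p i" "i \<noteq> j" by (auto simp: S_def j)
      have "1 \<le> \<bar>real i - real j\<bar>" using i by linarith
      then have "1 \<le> (real i - real j)\<^sup>2"
        using power_mono[of 1 "\<bar>real i - real j\<bar>" 2] by simp
      then show "x \<in> {x. inner w x \<ge> 1 - (real j)\<^sup>2}" using w i by simp
    qed
    then have "convex hull (S - {a}) \<subseteq> {x. inner w x \<ge> 1 - (real j)\<^sup>2}"
      by (rule hull_minimal) (rule convex_halfspace_ge)
    then show False using a w[of j] j by auto
  qed
  have "compact S" by (simp add: S_def finite_imp_compact)
  then have "vertices (convex hull S) = S"
    unfolding vertices_def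
    using extreme_point_of_convex_hull_convex_independent[OF _ indep] by auto
  then have "card (vertices (convex hull S)) = n"
    using card_image[OF inj] by (simp add: S_def)
  moreover have "S \<subseteq> grid (n^2) (n^4)"
  proof
    fix x assume "x \<in> S"
    then obtain i where i: "1 \<le> i" "i \<le> n" "x = p i" by (auto simp: S_def)
    have "i \<le> n\<^sup>2" using i(2) by (metis le_square le_trans power2_eq_square)
    moreover have "i\<^sup>2 \<le> n^4"
      using i power_mono[of i n 2] power_increasing[of 2 4 n] by linarith
    ultimately show "x \<in> grid (n^2) (n^4)"
      unfolding grid_def p_def i(3) using i(1)
      by (intro CollectI exI[of _ i] exI[of _ "i\<^sup>2"]) auto
  qed
  ultimately show ?thesis
    unfolding grid_polygons_def polytopes_on_def by blast
qed

end

theory Submission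
  imports Defs "Jordan_Normal_Form.Determinant"
begin

text \<open>
  A counting argument.  For an \<open>n\<close>-element set \<open>S\<close> of integers in \<open>{1..n\<^sup>2}\<close> let \<open>P\<^sub>S\<close> be the polygon with
  the vertices \<open>(i, i\<^sup>2)\<close>, \<open>i \<in> S\<close>; there are at least \<open>n\<^sup>n\<close> such polygons.  If \<open>i \<notin> S\<close>, then all of \<open>P\<^sub>S\<close>
  has vertical distance at least 1 from the tangent of the parabola at \<open>(i, i\<^sup>2)\<close>.

  Given a formulation of \<open>P\<^sub>S\<close> with a matrix inequality of size \<open>k\<close>, choose preimages of the vertices and
  consider the vectors consisting of the matrix at the preimage, the vertex, and 1.  A subfamily of
  maximal determinant expresses all of them with coefficients in \<open>[-1, 1]\<close>, and has only \<open>e + 3\<close> members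
  where \<open>e\<close> is the number of possibly nonzero matrix entries (\<open>k\<^sup>2\<close>, or \<open>k\<close> for diagonal matrices).  After
  a change of coordinates the sum of the matrices in the subfamily is an identity matrix, so their
  entries are in \<open>[-1, 1]\<close>.  The indices of the subfamily and these entries, rounded to a precision
  polynomial in \<open>n\<close>, determine \<open>S\<close>: with equal codes for \<open>S\<close> and \<open>S'\<close> and \<open>i \<in> S - S'\<close>, a point close to
  \<open>(i, i\<^sup>2)\<close> would belong to \<open>P\<^sub>S\<^sub>'\<close>.  Hence there are only \<open>n\<close> to the power \<open>O(e\<^sup>2)\<close> polygons, and \<open>n = O(e\<^sup>2)\<close>.
\<close>

subsection \<open>Barycentric spanners\<close>

text \<open>Gaussian elimination, one coordinate \<open>d\<close> at a time: if some vector has a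
  nonzero entry at \<open>d\<close>, it becomes the pivot \<open>p\<close>, and subtracting
  multiples of it clears \<open>d\<close> from all vectors before the recursion on
  \<open>C\<close>.\<close>

lemma spanning_subfamily:
  fixes u :: "'i \<Rightarrow> 'c \<Rightarrow> real"
  assumes "finite C" and "finite I"
  obtains J where "J \<subseteq> I" "card J \<le> card C"
    "\<forall>i\<in>I. \<exists>l. \<forall>c\<in>C. u i c = (\<Sum>j\<in>J. l j * u j c)"
proof -
  have "\<exists>J\<subseteq>I. card J \<le> card C \<and> (\<forall>i\<in>I. \<exists>l. \<forall>c\<in>C. u i c = (\<Sum>j\<in>J. l j * u j c))"
    using assms
  proof (induction C arbitrary: I u rule: finite_induct)
    case empty
    show ?case by (rule exI[of _ "{}"]) auto
  next
    case (insert d C)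
    show ?case
    proof (cases "\<forall>i\<in>I. u i d = 0")
      case True
      from insert.IH[OF insert.prems, of u] obtain J where
        J: "J \<subseteq> I" "card J \<le> card C" "\<forall>i\<in>I. \<exists>l. \<forall>c\<in>C. u i c = (\<Sum>j\<in>J. l j * u j c)"
        by blast
      have "(\<Sum>j\<in>J. l j * u j d) = 0" for l
        using True J(1) by (intro sum.neutral) auto
      with J True have "\<forall>i\<in>I. \<exists>l. \<forall>c\<in>insert d C. u i c = (\<Sum>j\<in>J. l j * u j c)"
        by (metis insert_iff)
      moreover have "card J \<le> card (insert d C)"
        using J(2) insert.hyps by simp
      ultimately show ?thesis using J(1) by blast
    next
      case False
      then obtain p where p: "p \<in> I" "u p d \<noteq> 0" by blast
      define w where "w i c = u i c - u i d / u p d * u p c" for i c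
      from insert.IH[of "I - {p}" w] insert.prems obtain J where
        J: "J \<subseteq> I - {p}" "card J \<le> card C"
          "\<forall>i\<in>I-{p}. \<exists>l. \<forall>c\<in>C. w i c = (\<Sum>j\<in>J. l j * w j c)"
        by auto
      have finJ: "finite J" and pJ: "p \<notin> J"
        using J(1) insert.prems finite_subset by blast+
      have "\<exists>l. \<forall>c\<in>insert d C. u i c = (\<Sum>j\<in>insert p J. l j * u j c)" if i: "i \<in> I" for i
      proof (cases "i = p")
        case True
        have "(\<Sum>j\<in>insert p J. (if j = p then 1 else 0) * u j c) = u p c" for c
          using finJ pJ by (simp add: if_distrib[of "\<lambda>x. x * _"] sum.delta cong: if_cong)
        then show ?thesis using True by (intro exI[of _ "\<lambda>j. if j = p then 1 else 0"]) auto
      next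
        case False
        with i J(3) obtain l where l: "\<forall>c\<in>C. w i c = (\<Sum>j\<in>J. l j * w j c)" by blast
        have wd: "w j d = 0" for j using p(2) by (simp add: w_def)
        define e where "e = u i d / u p d - (\<Sum>j\<in>J. l j * (u j d / u p d))"
        have "u i c = (\<Sum>j\<in>insert p J. (l(p := e)) j * u j c)" if c: "c \<in> insert d C" for c
        proof -
          have "w i c = (\<Sum>j\<in>J. l j * w j c)"
            using c l wd by auto
          also have "\<dots> = (\<Sum>j\<in>J. l j * u j c) - (\<Sum>j\<in>J. l j * (u j d / u p d)) * u p c"
            by (simp add: w_def algebra_simps sum_subtractf sum_distrib_left sum_distrib_right)
          finally have "u i c = (\<Sum>j\<in>J. l j * u j c) + e * u p c"
            by (simp add: w_def e_def algebra_simps)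
          moreover have "(\<Sum>j\<in>J. (l(p := e)) j * u j c) = (\<Sum>j\<in>J. l j * u j c)"
            using pJ by (intro sum.cong) auto
          ultimately show ?thesis using finJ pJ by simp
        qed
        then show ?thesis by blast
      qed
      moreover have "card (insert p J) \<le> card (insert d C)"
        using J(2) insert.hyps finJ pJ by simp
      moreover have "insert p J \<subseteq> I" using J(1) p(1) by blast
      ultimately show ?thesis by blast
    qed
  qed
  then show ?thesis using that by blast
qed

text \<open>
  A square subfamily of maximal determinant: by Cramer's rule the coefficients with respect to it
  are quotients of determinants, hence at most 1 in absolute value.
\<close>

lemma max_det_columns:
  fixes g :: "'i \<Rightarrow> nat \<Rightarrow> real"
  assumes "finite I" and e: "\<forall>a<r. e a \<in> I"
    and id: "\<forall>a<r. \<forall>b<r. g (e a) b = (if a = b then 1 else 0)"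
  obtains f where "\<forall>a<r. f a \<in> I"
    "\<forall>i\<in>I. \<exists>x. (\<forall>a<r. \<bar>x a\<bar> \<le> 1) \<and> (\<forall>b<r. g i b = (\<Sum>a<r. x a * g (f a) b))"
proof -
  define A where "A f = Matrix.mat r r (\<lambda>(b, a). g (f a) b)" for f
  have A: "A f \<in> carrier_mat r r" for f by (simp add: A_def)
  define F where "F = {..<r} \<rightarrow>\<^sub>E I"
  have finF: "finite F" using assms(1) by (simp add: F_def finite_PiE)
  have eF: "restrict e {..<r} \<in> F" using e by (auto simp: F_def)
  define h where "h f = \<bar>Determinant.det (A f)\<bar>" for f
  have "\<exists>f\<in>F. \<forall>f'\<in>F. h f' \<le> h f"
  proof -
    have "Max (h ` F) \<in> h ` F" using finF eF by (intro Max_in) auto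
    then obtain f where f: "f \<in> F" "h f = Max (h ` F)" by fastforce
    then show ?thesis using finF by (metis Max_ge finite_imageI imageI)
  qed
  then obtain f where f: "f \<in> F" and max: "\<And>f'. f' \<in> F \<Longrightarrow> h f' \<le> h f" by blast
  \<comment> \<open>The given unit vectors are one of the candidates, so the maximal determinant is
    at least 1 in absolute value and the matrix is invertible.\<close>
  have "A (restrict e {..<r}) = 1\<^sub>m r"
    using id by (intro eq_matI) (auto simp: A_def)
  then have "h (restrict e {..<r}) = 1" by (simp add: h_def)
  with max[OF eF] have h1: "1 \<le> h f" by simp
  then have det0: "Determinant.det (A f) \<noteq> 0" by (auto simp: h_def)
  have fI: "\<forall>a<r. f a \<in> I" using f by (auto simp: F_def)
  have "\<exists>x. (\<forall>a<r. \<bar>x a\<bar> \<le> 1) \<and> (\<forall>b<r. g i b = (\<Sum>a<r. x a * g (f a) b))" if i: "i \<in> I" for i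
  proof -
    define y where "y = Matrix.vec r (g i)"
    from det_non_zero_imp_unit[OF A det0, of undefined]
    obtain B where B: "B \<in> carrier_mat r r" "A f * B = 1\<^sub>m r"
      unfolding Units_def by (auto simp: ring_mat_def)
    define x where "x = B *\<^sub>v y"
    have x: "x \<in> carrier_vec r" using B by (simp add: x_def y_def)
    have Ax: "A f *\<^sub>v x = y"
    proof -
      have "A f *\<^sub>v x = (A f * B) *\<^sub>v y"
        unfolding x_def using A[of f] B(1) by (intro assoc_mult_mat_vec[symmetric]) (auto simp: y_def)
      then show ?thesis using B(2) by (simp add: y_def)
    qed
    have "\<bar>vec_index x a\<bar> \<le> 1" if a: "a < r" for a
    proof -
      \<comment> \<open>The numerator in Cramer's rule is the determinant of another candidate, in
        which \<open>i\<close> takes the place of \<open>f a\<close>.\<close>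
      have "replace_col (A f) y a = A (f(a := i))"
        by (intro eq_matI) (auto simp: replace_col_def A_def y_def)
      with cramer_lemma_mat[OF A x a, of f] Ax
      have "Determinant.det (A (f(a := i))) = vec_index x a * Determinant.det (A f)" by simp
      then have "\<bar>vec_index x a\<bar> * h f = h (f(a := i))" by (simp add: h_def abs_mult)
      also have "f(a := i) \<in> F"
        using f a i unfolding F_def by (simp add: PiE_iff extensional_def) 
      then have "h (f(a := i)) \<le> h f" by (rule max)
      finally show ?thesis using h1 by simp
    qed
    moreover have "g i b = (\<Sum>a<r. vec_index x a * g (f a) b)" if b: "b < r" for b
    proof -
      have "g i b = vec_index (A f *\<^sub>v x) b" using Ax b by (simp add: y_def)
      also have "\<dots> = (\<Sum>a<r. vec_index x a * g (f a) b)"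
        using b x by (auto simp: A_def scalar_prod_def atLeast0LessThan mult.commute intro!: sum.cong)
      finally show ?thesis .
    qed
    ultimately show ?thesis by blast
  qed
  with fI show ?thesis using that by blast
qed

text \<open>Coordinates with respect to a spanning subfamily \<open>J\<close> reduce this to the
  square case. The length is \<open>card C\<close> whatever the rank of the family, so that spanners
  of different families have the same shape.\<close>

lemma barycentric_spanner:
  fixes u :: "'i \<Rightarrow> 'c \<Rightarrow> real"
  assumes "finite C" and "finite I" and "I \<noteq> {}"
  obtains f where "\<forall>a<card C. f a \<in> I"
    "\<forall>i\<in>I. \<exists>x. (\<forall>a<card C. \<bar>x a\<bar> \<le> 1) \<and> (\<forall>c\<in>C. u i c = (\<Sum>a<card C. x a * u (f a) c))"
proof -
  obtain J where J: "J \<subseteq> I" "card J \<le> card C"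
    "\<forall>i\<in>I. \<exists>l. \<forall>c\<in>C. u i c = (\<Sum>j\<in>J. l j * u j c)"
    using spanning_subfamily[OF assms(1,2)] by blast
  have finJ: "finite J" using J(1) assms(2) finite_subset by blast
  define r where "r = card J"
  obtain e where e: "bij_betw e {..<r} J"
    using ex_bij_betw_nat_finite[OF finJ] by (auto simp: r_def atLeast0LessThan)
  obtain l where l: "\<And>i c. i \<in> I \<Longrightarrow> c \<in> C \<Longrightarrow> u i c = (\<Sum>j\<in>J. l i j * u j c)"
    using J(3) by metis
  \<comment> \<open>Members of \<open>J\<close> get unit vectors as coordinates by fiat:
    \<open>l\<close> need not be unique, and the determinant argument needs an identity
    matrix.\<close>
  define g where "g i a = (if i \<in> J then if i = e a then 1 else 0 else l i (e a))" for i a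
  have eJ: "e a \<in> J" if "a < r" for a using e that by (auto simp: bij_betw_def)
  have ei: "e a = e b \<longleftrightarrow> a = b" if "a < r" "b < r" for a b
    using e that by (auto simp: bij_betw_def inj_on_def)
  have u: "u i c = (\<Sum>a<r. g i a * u (e a) c)" if "i \<in> I" "c \<in> C" for i c
  proof (cases "i \<in> J")
    case True
    then obtain b where b: "b < r" "i = e b" using e by (auto simp: bij_betw_def)
    have "(\<Sum>a<r. g i a * u (e a) c) = (\<Sum>a<r. if a = b then u i c else 0)"
      using b eJ ei by (intro sum.cong) (auto simp: g_def)
    then show ?thesis using b by simp
  next
    case False
    then show ?thesis
      using l[OF that] sum.reindex_bij_betw[OF e, of "\<lambda>j. l i j * u j c"] by (simp add: g_def)
  qed
  obtain f where f: "\<forall>a<r. f a \<in> I"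
    "\<forall>i\<in>I. \<exists>x. (\<forall>a<r. \<bar>x a\<bar> \<le> 1) \<and> (\<forall>b<r. g i b = (\<Sum>a<r. x a * g (f a) b))"
  proof (rule max_det_columns[OF assms(2), of r e g])
    show "\<forall>a<r. e a \<in> I" using eJ J(1) by blast
    show "\<forall>a<r. \<forall>b<r. g (e a) b = (if a = b then 1 else 0)" using eJ ei by (auto simp: g_def)
  qed blast
  obtain i0 where i0: "i0 \<in> I" using assms(3) by blast
  have rC: "r \<le> card C" using J(2) by (simp add: r_def)
  \<comment> \<open>Padding to length \<open>card C\<close> with an arbitrary member, which receives
    coefficient 0.\<close>
  define f' where "f' a = (if a < r then f a else i0)" for a
  have "\<exists>x. (\<forall>a<card C. \<bar>x a\<bar> \<le> 1) \<and> (\<forall>c\<in>C. u i c = (\<Sum>a<card C. x a * u (f' a) c))"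
    if i: "i \<in> I" for i
  proof -
    from f(2) i obtain x where x: "\<forall>a<r. \<bar>x a\<bar> \<le> 1" "\<forall>b<r. g i b = (\<Sum>a<r. x a * g (f a) b)"
      by blast
    define x' where "x' a = (if a < r then x a else 0)" for a
    have "u i c = (\<Sum>a<card C. x' a * u (f' a) c)" if c: "c \<in> C" for c
    proof -
      have "u i c = (\<Sum>b<r. (\<Sum>a<r. x a * g (f a) b) * u (e b) c)"
        using u[OF i c] x(2) by simp
      also have "\<dots> = (\<Sum>b<r. \<Sum>a<r. x a * (g (f a) b * u (e b) c))"
        by (simp add: sum_distrib_right mult.assoc)
      also have "\<dots> = (\<Sum>a<r. \<Sum>b<r. x a * (g (f a) b * u (e b) c))"
        by (rule sum.swap)
      also have "\<dots> = (\<Sum>a<r. x a * u (f a) c)"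
        using f(1) c by (intro sum.cong refl) (simp add: u sum_distrib_left)
      also have "\<dots> = (\<Sum>a<r. x' a * u (f' a) c)"
        by (intro sum.cong) (auto simp: x'_def f'_def)
      also have "\<dots> = (\<Sum>a<card C. x' a * u (f' a) c)"
        using rC by (intro sum.mono_neutral_left) (auto simp: x'_def)
      finally show ?thesis .
    qed
    moreover have "\<forall>a<card C. \<bar>x' a\<bar> \<le> 1" using x(1) by (auto simp: x'_def)
    ultimately show ?thesis by blast
  qed
  moreover have "\<forall>a<card C. f' a \<in> I" using f(1) i0 by (auto simp: f'_def)
  ultimately show ?thesis using that by blast
qed

subsection \<open>Semidefinite forms\<close>

definition bform :: "nat \<Rightarrow> (nat \<Rightarrow> nat \<Rightarrow> real) \<Rightarrow> (nat \<Rightarrow> real) \<Rightarrow> (nat \<Rightarrow> real) \<Rightarrow> real" where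
  "bform K A v w = (\<Sum>a<K. \<Sum>b<K. A a b * v a * w b)"

definition psd_form :: "nat \<Rightarrow> (nat \<Rightarrow> nat \<Rightarrow> real) \<Rightarrow> bool" where
  "psd_form K A \<longleftrightarrow> (\<forall>v. 0 \<le> bform K A v v)"

lemma bform_commute:
  assumes "\<And>a b. A a b = A b a"
  shows "bform K A v w = bform K A w v"
proof -
  have "A b a * v b * w a = A a b * w a * v b" for a b using assms[of a b] by simp
  then show ?thesis
    unfolding bform_def by (subst sum.swap) (intro sum.cong refl, simp)
qed

lemma bform_add_left: "bform K A (\<lambda>c. v c + v' c) w = bform K A v w + bform K A v' w"
  by (simp add: bform_def algebra_simps sum.distrib)

lemma bform_add_right: "bform K A w (\<lambda>c. v c + v' c) = bform K A w v + bform K A w v'"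
  by (simp add: bform_def algebra_simps sum.distrib)

lemma bform_scale_left: "bform K A (\<lambda>c. x * v c) w = x * bform K A v w"
  by (simp add: bform_def algebra_simps sum_distrib_left)

lemma bform_scale_right: "bform K A w (\<lambda>c. x * v c) = x * bform K A w v"
  by (simp add: bform_def algebra_simps sum_distrib_left)

lemma bform_diff_left: "bform K A (\<lambda>c. v c - v' c) w = bform K A v w - bform K A v' w"
  by (simp add: bform_def algebra_simps sum_subtractf)

lemma bform_zero_left [simp]: "bform K A (\<lambda>c. 0) w = 0"
  by (simp add: bform_def)

lemma bform_zero_right [simp]: "bform K A w (\<lambda>c. 0) = 0"
  by (simp add: bform_def)

lemma bform_sum_left:
  "finite F \<Longrightarrow> bform K A (\<lambda>c. \<Sum>a\<in>F. x a * y a c) w = (\<Sum>a\<in>F. x a * bform K A (y a) w)"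
  by (induction F rule: finite_induct) (simp_all add: bform_add_left bform_scale_left)

lemma bform_sum_right:
  "finite F \<Longrightarrow> bform K A w (\<lambda>c. \<Sum>a\<in>F. x a * y a c) = (\<Sum>a\<in>F. x a * bform K A w (y a))"
  by (induction F rule: finite_induct) (simp_all add: bform_add_right bform_scale_right)

lemma bform_matrix_add: "bform K (\<lambda>a b. A a b + B a b) v w = bform K A v w + bform K B v w"
  by (simp add: bform_def algebra_simps sum.distrib)

lemma bform_matrix_scale: "bform K (\<lambda>a b. x * A a b) v w = x * bform K A v w"
  by (simp add: bform_def algebra_simps sum_distrib_left)

lemma bform_matrix_zero [simp]: "bform K (\<lambda>a b. 0) v w = 0"
  by (simp add: bform_def)

lemma bform_matrix_sum:
  "bform K (\<lambda>a b. \<Sum>c<D. m c * A c a b) v w = (\<Sum>c<(D::nat). m c * bform K (A c) v w)"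
  by (induction D) (simp_all add: bform_matrix_add bform_matrix_scale)

lemma psd_formD: "psd_form K A \<Longrightarrow> 0 \<le> bform K A v v"
  by (simp add: psd_form_def)

lemma bform_square_add:
  assumes "\<And>a b. A a b = A b a"
  shows "bform K A (\<lambda>c. v c + x * w c) (\<lambda>c. v c + x * w c) =
    bform K A v v + 2 * x * bform K A v w + x\<^sup>2 * bform K A w w"
  using bform_commute[of A K w v, OF assms]
  by (simp add: bform_add_left bform_add_right bform_scale_left bform_scale_right
      power2_eq_square algebra_simps)

text \<open>Along the line \<open>y + x * z\<close> the quadratic term vanishes, and an affine
  function of \<open>x\<close> that is nonnegative everywhere has slope 0.\<close>

lemma psd_form_null:
  assumes sym: "\<And>a b. A a b = A b a" and psd: "psd_form K A" and z: "bform K A z z = 0"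
  shows "bform K A y z = 0"
proof (rule ccontr)
  assume nz: "bform K A y z \<noteq> 0"
  \<comment> \<open>With this \<open>x\<close> the affine function would take the value -1.\<close>
  define x where "x = - (bform K A y y + 1) / (2 * bform K A y z)"
  have "0 \<le> bform K A y y + 2 * x * bform K A y z + x\<^sup>2 * bform K A z z"
    using psd_formD[OF psd, of "\<lambda>c. y c + x * z c"] unfolding bform_square_add[OF sym] .
  also have "\<dots> = -1" using nz z by (simp add: x_def field_simps)
  finally show False by simp
qed

text \<open>Evaluate the form at \<open>v + w\<close> and \<open>v - w\<close>. This controls
  off-diagonal entries by diagonal ones.\<close>

lemma psd_form_cross_bound:
  assumes sym: "\<And>a b. A a b = A b a" and psd: "psd_form K A"
  shows "2 * \<bar>bform K A v w\<bar> \<le> bform K A v v + bform K A w w"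
proof -
  have "0 \<le> bform K A v v + 2 * x * bform K A v w + x\<^sup>2 * bform K A w w" for x
    using psd_formD[OF psd, of "\<lambda>c. v c + x * w c"] unfolding bform_square_add[OF sym] .
  from this[of 1] this[of "-1"] show ?thesis by auto
qed

text \<open>
  Completeness is meant modulo the null space of \<open>B\<close>.  The vectors outside \<open>R\<close> are 0, so that a form
  expressed in the vectors \<open>b a\<close> is again a \<open>K\<close> by \<open>K\<close> matrix, whatever the rank of \<open>B\<close>.
\<close>

definition complete_orthonormal ::
  "nat \<Rightarrow> (nat \<Rightarrow> nat \<Rightarrow> real) \<Rightarrow> nat set \<Rightarrow> (nat \<Rightarrow> nat \<Rightarrow> real) \<Rightarrow> bool" where
  "complete_orthonormal K B R b \<longleftrightarrow>
    R \<subseteq> {..<K} \<and> (\<forall>a. a \<notin> R \<longrightarrow> b a = (\<lambda>c. 0)) \<and>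
    (\<forall>a\<in>R. \<forall>a'\<in>R. bform K B (b a) (b a') = (if a = a' then 1 else 0)) \<and>
    (\<forall>v. bform K B (\<lambda>c. v c - (\<Sum>a\<in>R. bform K B v (b a) * b a c))
                   (\<lambda>c. v c - (\<Sum>a\<in>R. bform K B v (b a) * b a c)) = 0)"

text \<open>Among more than \<open>K\<close> vectors with \<open>K\<close> coordinates, one is a
  combination of others; pairing it with itself would give 0 instead of 1.\<close>

lemma orthonormal_length_le:
  assumes b: "\<forall>a<r. \<forall>a'<r. bform K B (b a) (b a') = (if a = a' then 1 else 0)"
  shows "r \<le> K"
proof (rule ccontr)
  assume "\<not> r \<le> K"
  obtain J where J: "J \<subseteq> {..<r}" "card J \<le> card {..<K}"
    "\<forall>i\<in>{..<r}. \<exists>l. \<forall>c\<in>{..<K}. b i c = (\<Sum>j\<in>J. l j * b j c)"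
    using spanning_subfamily[of "{..<K}" "{..<r}" b] by blast
  have finJ: "finite J" using J(1) finite_subset by blast
  have "J \<noteq> {..<r}" using J(2) \<open>\<not> r \<le> K\<close> by auto
  with J(1) obtain i where i: "i < r" "i \<notin> J" by auto
  with J(3) obtain l where l: "\<forall>c\<in>{..<K}. b i c = (\<Sum>j\<in>J. l j * b j c)" by blast
  have "bform K B (b i) (b i) = bform K B (\<lambda>c. \<Sum>j\<in>J. l j * b j c) (b i)"
    unfolding bform_def using l by (intro sum.cong refl) simp
  also have "\<dots> = (\<Sum>j\<in>J. l j * bform K B (b j) (b i))" by (rule bform_sum_left[OF finJ])
  also have "\<dots> = 0"
  proof (intro sum.neutral ballI)
    fix j assume "j \<in> J"
    then have "j < r" "j \<noteq> i" using i J(1) by auto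
    then show "l j * bform K B (b j) (b i) = 0" using b i(1) by simp
  qed
  finally show False using b i(1) by simp
qed

text \<open>An orthonormal system of maximal length is complete: a residual \<open>z\<close> on
  which the form is positive is orthogonal to the system, and after scaling it would extend the
  system.\<close>

lemma complete_orthonormal_exists:
  assumes sym: "\<And>a b. B a b = B b a" and psd: "psd_form K B"
  shows "\<exists>R b. complete_orthonormal K B R b"
proof -
  define Q where "Q r b \<longleftrightarrow> (\<forall>a<r. \<forall>a'<r. bform K B (b a) (b a') = (if a = a' then 1 else 0))"
    for r and b :: "nat \<Rightarrow> nat \<Rightarrow> real"
  define r where "r = Greatest (\<lambda>r. \<exists>b. Q r b)"
  have bound: "r' \<le> K" if "\<exists>b. Q r' b" for r'
    using that orthonormal_length_le unfolding Q_def by blast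
  have "\<exists>b. Q 0 b" by (simp add: Q_def)
  then have "\<exists>b. Q r b" unfolding r_def using bound by (rule GreatestI_nat)
  then obtain b0 where b0: "Q r b0" by blast
  have max: "r' \<le> r" if "Q r' b" for r' b
    unfolding r_def by (rule Greatest_le_nat) (use that bound in blast)+
  define b where "b a = (if a < r then b0 a else (\<lambda>c. 0))" for a
  have ortho: "bform K B (b a) (b a') = (if a = a' then 1 else 0)" if "a < r" "a' < r" for a a'
    using b0 that by (simp add: Q_def b_def)
  have "bform K B z z = 0" if z_def: "z = (\<lambda>c. v c - (\<Sum>a<r. bform K B v (b a) * b a c))" for v z
  proof (rule ccontr)
    assume nz: "bform K B z z \<noteq> 0"
    with psd_formD[OF psd, of z] have pos: "bform K B z z > 0" by simp
    have zb: "bform K B z (b a) = 0" if "a < r" for a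
    proof -
      have "bform K B z (b a) = bform K B v (b a) - (\<Sum>a'<r. bform K B v (b a') * bform K B (b a') (b a))"
        unfolding z_def by (simp add: bform_diff_left bform_sum_left)
      also have "(\<Sum>a'<r. bform K B v (b a') * bform K B (b a') (b a)) =
          (\<Sum>a'<r. if a' = a then bform K B v (b a') else 0)"
        using ortho that by (intro sum.cong) auto
      finally show ?thesis using that by simp
    qed
    define x where "x = 1 / sqrt (bform K B z z)"
    define b' where "b' = b(r := (\<lambda>c. x * z c))"
    have "Q (Suc r) b'"
      unfolding Q_def
    proof (intro allI impI)
      fix a a' assume aa: "a < Suc r" "a' < Suc r"
      have "x * x = 1 / bform K B z z" using pos by (simp add: x_def)
      then have zz: "x * (x * bform K B z z) = 1"
        using pos by (simp only: mult.assoc[symmetric]) simp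
      have bz: "bform K B (b a) z = 0" if "a < r" for a
        using zb[OF that] bform_commute[of B K "b a" z, OF sym] by simp
      consider "a < r" "a' < r" | "a < r" "a' = r" | "a = r" "a' < r" | "a = r" "a' = r"
        using aa by linarith
      then show "bform K B (b' a) (b' a') = (if a = a' then 1 else 0)"
        by cases (simp_all add: b'_def ortho zb bz zz bform_scale_left bform_scale_right)
    qed
    then show False using max[of "Suc r" b'] by simp
  qed
  then have "complete_orthonormal K B {..<r} b"
    unfolding complete_orthonormal_def using ortho bound[OF \<open>\<exists>b. Q r b\<close>] by (auto simp: b_def)
  then show ?thesis by blast
qed

lemma bform_diagonal:
  assumes "\<And>a b. a \<noteq> b \<Longrightarrow> B a b = 0"
  shows "bform K B v w = (\<Sum>a<K. B a a * v a * w a)"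
proof -
  have "(\<Sum>b<K. B a b * v a * w b) = (\<Sum>b<K. if b = a then B a a * v a * w a else 0)" for a
    using assms by (intro sum.cong) auto
  then show ?thesis by (simp add: bform_def)
qed

text \<open>Rescaled unit vectors at the positive diagonal entries suffice; the remaining
  coordinates span the null space.\<close>

lemma complete_orthonormal_diagonal:
  assumes diag: "\<And>a b. a \<noteq> b \<Longrightarrow> B a b = 0" and psd: "psd_form K B"
  shows "\<exists>R b. complete_orthonormal K B R b \<and> (\<forall>a c. a \<noteq> c \<longrightarrow> b a c = 0)"
proof -
  have form: "bform K B v w = (\<Sum>a<K. B a a * v a * w a)" for v w
    by (rule bform_diagonal) (rule diag)
  define R where "R = {a. a < K \<and> B a a \<noteq> 0}"
  define b where "b a c = (if a = c \<and> a \<in> R then 1 / sqrt (B a a) else 0)" for a c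
  have pos: "0 \<le> B a a" if "a < K" for a
  proof -
    have "(\<Sum>c<K. B c c * (if c = a then 1 else 0) * (if c = a then 1 else 0)) =
        (\<Sum>c<K. if c = a then B a a else 0)"
      by (intro sum.cong) auto
    then show ?thesis
      using psd_formD[OF psd, of "\<lambda>c. if c = a then 1 else 0"] that
      by (simp add: form)
  qed
  have vb: "bform K B v (b a) = sqrt (B a a) * v a" if "a \<in> R" for v a
  proof -
    have a: "a < K" "B a a > 0" using that pos[of a] by (auto simp: R_def)
    have "bform K B v (b a) = (\<Sum>c<K. if c = a then B a a * v a * (1 / sqrt (B a a)) else 0)"
      unfolding form using that by (intro sum.cong) (auto simp: b_def)
    also have "\<dots> = B a a / sqrt (B a a) * v a" using a by simp
    finally show ?thesis using a by (simp add: real_div_sqrt)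
  qed
  have finR: "finite R" by (simp add: R_def)
  have "bform K B z z = 0" if z_def: "z = (\<lambda>c. v c - (\<Sum>a\<in>R. bform K B v (b a) * b a c))" for v z
  proof -
    have "z c = 0" if c: "c \<in> R" for c
    proof -
      have "(\<Sum>a\<in>R. bform K B v (b a) * b a c) = (\<Sum>a\<in>R. if a = c then v c else 0)"
        using c pos by (intro sum.cong) (auto simp: vb b_def R_def)
      then show ?thesis using c finR by (simp add: z_def)
    qed
    then show ?thesis
      unfolding form by (intro sum.neutral) (auto simp: R_def)
  qed
  moreover have "bform K B (b a) (b a') = (if a = a' then 1 else 0)" if "a \<in> R" "a' \<in> R" for a a'
    using that pos[of a'] by (auto simp: vb b_def R_def)
  ultimately have "complete_orthonormal K B R b"
    unfolding complete_orthonormal_def by (auto simp: R_def b_def)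
  moreover have "\<forall>a c. a \<noteq> c \<longrightarrow> b a c = 0" by (simp add: b_def)
  ultimately show ?thesis by blast
qed

section \<open>Zero patterns of semidefinite matrices\<close>

text \<open>With \<open>E\<close> the full square or the diagonal, general and linear formulations
  are treated by the same argument.\<close>

definition supported_sym_psd :: "nat \<Rightarrow> (nat \<times> nat) set \<Rightarrow> (nat \<Rightarrow> nat \<Rightarrow> real) \<Rightarrow> bool" where
  "supported_sym_psd K E A \<longleftrightarrow>
    (\<forall>a b. A a b = A b a) \<and> psd_form K A \<and> (\<forall>a b. (a, b) \<notin> E \<longrightarrow> A a b = 0)"

text \<open>
  Normalizing \<open>B\<close> to the identity must not destroy the zero pattern; for the diagonal pattern this
  forces the orthonormal system to consist of multiples of unit vectors.
\<close>

definition pattern_stable :: "nat \<Rightarrow> (nat \<times> nat) set \<Rightarrow> bool" where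
  "pattern_stable K E \<longleftrightarrow>
    (\<forall>B. supported_sym_psd K E B \<longrightarrow>
      (\<exists>R b. complete_orthonormal K B R b \<and>
        (\<forall>A. supported_sym_psd K E A \<longrightarrow>
          (\<forall>a a'. (a, a') \<notin> E \<longrightarrow> bform K A (b a) (b a') = 0))))"

text \<open>Indices outside the square are outside \<open>R\<close>, where the vectors of the system
  are 0.\<close>

lemma pattern_stable_full: "pattern_stable K ({..<K} \<times> {..<K})"
  unfolding pattern_stable_def
proof (intro allI impI)
  fix B assume B: "supported_sym_psd K ({..<K} \<times> {..<K}) B"
  then obtain R b where Rb: "complete_orthonormal K B R b"
    using complete_orthonormal_exists unfolding supported_sym_psd_def by metis
  have "bform K A (b a) (b a') = 0" if "(a, a') \<notin> {..<K} \<times> {..<K}" for A a a'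
  proof -
    have "a \<notin> R \<or> a' \<notin> R" using that Rb unfolding complete_orthonormal_def by auto
    then have "b a = (\<lambda>c. 0) \<or> b a' = (\<lambda>c. 0)" using Rb unfolding complete_orthonormal_def by auto
    then show ?thesis by auto
  qed
  with Rb show "\<exists>R b. complete_orthonormal K B R b \<and>
        (\<forall>A. supported_sym_psd K ({..<K} \<times> {..<K}) A \<longrightarrow>
          (\<forall>a a'. (a, a') \<notin> {..<K} \<times> {..<K} \<longrightarrow> bform K A (b a) (b a') = 0))"
    by blast
qed

text \<open>Distinct vectors of the system have disjoint supports, so every diagonal form vanishes
  on such a pair.\<close>

lemma pattern_stable_diagonal: "pattern_stable K ((\<lambda>a. (a, a)) ` {..<K})"
  unfolding pattern_stable_def
proof (intro allI impI)
  let ?E = "(\<lambda>a. (a, a)) ` {..<K}"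
  fix B assume B: "supported_sym_psd K ?E B"
  have off: "A a b = 0" if "supported_sym_psd K ?E A" "a \<noteq> b" for A a b
  proof -
    have "(a, b) \<notin> ?E" using that(2) by auto
    with that(1) show ?thesis unfolding supported_sym_psd_def by blast
  qed
  have "\<exists>R b. complete_orthonormal K B R b \<and> (\<forall>a c. a \<noteq> c \<longrightarrow> b a c = 0)"
  proof (rule complete_orthonormal_diagonal)
    show "B a b = 0" if "a \<noteq> b" for a b using off[OF B that] .
    show "psd_form K B" using B unfolding supported_sym_psd_def by blast
  qed
  then obtain R b where Rb: "complete_orthonormal K B R b" "\<forall>a c. a \<noteq> c \<longrightarrow> b a c = 0"
    by blast
  have "bform K A (b a) (b a') = 0" if A: "supported_sym_psd K ?E A" and "(a, a') \<notin> ?E" for A a a'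
  proof (cases "a = a'")
    case True
    then have "a \<notin> R" using that Rb(1) unfolding complete_orthonormal_def by auto
    then have "b a = (\<lambda>c. 0)" using Rb(1) unfolding complete_orthonormal_def by auto
    then show ?thesis by simp
  next
    case False
    have "\<forall>c. b a c = 0 \<or> b a' c = 0" using False Rb(2) by metis
    then have "A c c * b a c * b a' c = 0" for c by (metis mult_eq_0_iff)
    moreover have "bform K A (b a) (b a') = (\<Sum>c<K. A c c * b a c * b a' c)"
      by (rule bform_diagonal) (rule off[OF A])
    ultimately show ?thesis by (simp only: sum.neutral_const)
  qed
  with Rb(1) show "\<exists>R b. complete_orthonormal K B R b \<and>
        (\<forall>A. supported_sym_psd K ?E A \<longrightarrow>
          (\<forall>a a'. (a, a') \<notin> ?E \<longrightarrow> bform K A (b a) (b a') = 0))"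
    by blast
qed

subsection \<open>Normal forms of matrix inequalities\<close>

text \<open>
  \<open>A i\<close> is the value of the matrix map at a preimage of \<open>p i\<close>, padded with zeros to size \<open>K\<close>.
\<close>

definition lmi_data :: "nat \<Rightarrow> (nat \<times> nat) set \<Rightarrow> ('i \<Rightarrow> 'a::euclidean_space) \<Rightarrow> 'i set \<Rightarrow> 'a set \<Rightarrow>
    ('i \<Rightarrow> nat \<Rightarrow> nat \<Rightarrow> real) \<Rightarrow> bool" where
  "lmi_data K E p S P A \<longleftrightarrow>
    (\<forall>i\<in>S. supported_sym_psd K E (A i)) \<and>
    (\<forall>(D::nat) j m. (\<forall>c<D. j c \<in> S) \<longrightarrow> (\<Sum>c<D. m c) = 1 \<longrightarrow>
      psd_form K (\<lambda>a b. \<Sum>c<D. m c * A (j c) a b) \<longrightarrow> (\<Sum>c<D. m c *\<^sub>R p (j c)) \<in> P)"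

text \<open>
  The spanner \<open>j\<close> together with the matrices at its points, in coordinates in which their sum is the
  identity on \<open>R\<close>.  This sum is the interior point that absorbs rounding errors.
\<close>

definition normal_form :: "nat \<Rightarrow> (nat \<times> nat) set \<Rightarrow> nat \<Rightarrow> ('i \<Rightarrow> 'a::euclidean_space) \<Rightarrow> 'i set \<Rightarrow>
    'a set \<Rightarrow> (nat \<Rightarrow> 'i) \<Rightarrow> (nat \<Rightarrow> nat \<Rightarrow> nat \<Rightarrow> real) \<Rightarrow> bool" where
  "normal_form K E D p S P j N \<longleftrightarrow>
    (\<forall>c<D. j c \<in> S) \<and>
    (\<forall>c<D. \<forall>a b. \<bar>N c a b\<bar> \<le> 1 \<and> ((a, b) \<notin> E \<longrightarrow> N c a b = 0)) \<and>
    (\<exists>R\<subseteq>{..<K}. (\<forall>c<D. \<forall>a b. a \<notin> R \<or> b \<notin> R \<longrightarrow> N c a b = 0) \<and>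
      (\<forall>w. (\<Sum>c<D. bform K (N c) w w) = (\<Sum>a\<in>R. (w a)\<^sup>2))) \<and>
    (\<forall>i\<in>S. \<exists>l. (\<forall>c<D. \<bar>l c\<bar> \<le> 1) \<and> (\<Sum>c<D. l c) = 1 \<and> p i = (\<Sum>c<D. l c *\<^sub>R p (j c)) \<and>
      psd_form K (\<lambda>a b. \<Sum>c<D. l c * N c a b)) \<and>
    (\<forall>m. (\<Sum>c<D. m c) = 1 \<longrightarrow> psd_form K (\<lambda>a b. \<Sum>c<D. m c * N c a b) \<longrightarrow>
      (\<Sum>c<D. m c *\<^sub>R p (j c)) \<in> P)"

text \<open>The change of coordinates discards only the null space of \<open>B\<close>. Each matrix
  of the spanner is dominated by \<open>B\<close>, so it vanishes there as well and semidefiniteness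
  of combinations carries over in both directions.\<close>

lemma normal_form_exists:
  fixes p :: "'i \<Rightarrow> 'a::euclidean_space"
  assumes data: "lmi_data K E p S P A" and S: "finite S" "S \<noteq> {}" and E: "finite E"
    and stable: "pattern_stable K E"
  obtains j N where "normal_form K E (card E + DIM('a) + 1) p S P j N"
proof -
  define D where "D = card E + DIM('a) + 1"
  \<comment> \<open>Coordinates of the spanned vectors: the entries in \<open>E\<close>, the
    constant 1 at \<open>None\<close>, which makes the combinations affine, and the components of
    the point.\<close>
  define C where "C = E <+> insert None (Some ` (Basis :: 'a set))"
  define u where "u i x = (case x of Inl (a, b) \<Rightarrow> A i a b | Inr None \<Rightarrow> 1 | Inr (Some e) \<Rightarrow> inner (p i) e)"
    for i and x :: "(nat \<times> nat) + 'a option"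
  have "finite C" using E by (simp add: C_def)
  have "card (insert None (Some ` (Basis :: 'a set))) = DIM('a) + 1"
    by (subst card_insert_disjoint) (auto simp: card_image)
  then have cardC: "card C = D"
    using E by (simp add: C_def D_def card_Plus)
  obtain j where j: "\<forall>c<D. j c \<in> S"
    "\<forall>i\<in>S. \<exists>l. (\<forall>c<D. \<bar>l c\<bar> \<le> 1) \<and> (\<forall>x\<in>C. u i x = (\<Sum>c<D. l c * u (j c) x))"
    using barycentric_spanner[OF \<open>finite C\<close> S, of u] unfolding cardC by blast
  have sup: "supported_sym_psd K E (A (j c))" if "c < D" for c
    using data j(1) that by (auto simp: lmi_data_def)
  have sym: "A (j c) a b = A (j c) b a" and psd: "psd_form K (A (j c))" if "c < D" for c a b
    using sup[OF that] unfolding supported_sym_psd_def by blast+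
  define B where "B a b = (\<Sum>c<D. A (j c) a b)" for a b
  have B: "bform K B v w = (\<Sum>c<D. bform K (A (j c)) v w)" for v w
    using bform_matrix_sum[of K "\<lambda>_. 1" "\<lambda>c. A (j c)" D] by (simp add: B_def[abs_def])
  have le: "bform K (A (j c)) v v \<le> bform K B v v" if "c < D" for c v
    unfolding B using that psd_formD[OF psd]
    by (intro member_le_sum[of c _ "\<lambda>c. bform K (A (j c)) v v"]) auto
  have "psd_form K B"
    unfolding psd_form_def B using psd_formD[OF psd] by (auto intro!: sum_nonneg)
  moreover have "B a b = B b a" for a b
    unfolding B_def using sym by (intro sum.cong) auto
  moreover have "B a b = 0" if "(a, b) \<notin> E" for a b
    unfolding B_def using sup that by (intro sum.neutral) (auto simp: supported_sym_psd_def)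
  ultimately have "supported_sym_psd K E B" unfolding supported_sym_psd_def by blast
  then obtain R b where Rb: "complete_orthonormal K B R b"
    and off: "\<And>A a a'. supported_sym_psd K E A \<Longrightarrow> (a, a') \<notin> E \<Longrightarrow> bform K A (b a) (b a') = 0"
    using stable unfolding pattern_stable_def by blast
  have R: "R \<subseteq> {..<K}" and b0: "\<And>a. a \<notin> R \<Longrightarrow> b a = (\<lambda>c. 0)"
    and ortho: "\<And>a a'. a \<in> R \<Longrightarrow> a' \<in> R \<Longrightarrow> bform K B (b a) (b a') = (if a = a' then 1 else 0)"
    and res: "\<And>v. bform K B (\<lambda>c. v c - (\<Sum>a\<in>R. bform K B v (b a) * b a c))
                   (\<lambda>c. v c - (\<Sum>a\<in>R. bform K B v (b a) * b a c)) = 0"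
    using Rb unfolding complete_orthonormal_def by blast+
  define N where "N c a a' = bform K (A (j c)) (b a) (b a')" for c a a'
  \<comment> \<open>\<open>T\<close> maps new coordinates to old ones, so \<open>N c\<close> is the
    congruence transform of \<open>A (j c)\<close>.\<close>
  define T where "T w = (\<lambda>x. \<Sum>a<K. w a * b a x)" for w
  have T: "bform K F (T w) (T w) = bform K (\<lambda>a a'. bform K F (b a) (b a')) w w" for F w
    unfolding T_def
    by (simp add: bform_sum_left bform_sum_right)
       (simp add: bform_def sum_distrib_left mult_ac)
  have NT: "bform K (N c) w w = bform K (A (j c)) (T w) (T w)" for c w
    unfolding T N_def[abs_def] ..
  have Bb: "bform K B (b a) (b a') = (if a = a' \<and> a \<in> R then 1 else 0)" for a a'
    using ortho b0 by (cases "a \<in> R"; cases "a' \<in> R") auto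
  have sumT: "bform K (\<lambda>a a'. \<Sum>c<D. m c * N c a a') w w =
      bform K (\<lambda>a a'. \<Sum>c<D. m c * A (j c) a a') (T w) (T w)" for m w
    by (simp add: bform_matrix_sum NT)
  \<comment> \<open>Diagonal entries are at most those of \<open>B\<close> in the new basis, which
    are 0 or 1; the cross bound handles the others.\<close>
  have n1: "\<bar>N c a a'\<bar> \<le> 1" if "c < D" for c a a'
  proof -
    have "2 * \<bar>N c a a'\<bar> \<le> bform K (A (j c)) (b a) (b a) + bform K (A (j c)) (b a') (b a')"
      unfolding N_def using sym[OF that] psd[OF that] by (intro psd_form_cross_bound) auto
    also have "\<dots> \<le> bform K B (b a) (b a) + bform K B (b a') (b a')"
      using le[OF that] by (intro add_mono)
    also have "\<dots> \<le> 2" using Bb by simp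
    finally show ?thesis by simp
  qed
  have n2: "N c a a' = 0" if "c < D" "(a, a') \<notin> E" for c a a'
    unfolding N_def using off[OF sup[OF that(1)] that(2)] .
  have n3: "N c a a' = 0" if "a \<notin> R \<or> a' \<notin> R" for c a a'
    unfolding N_def using that b0 by auto
  have n4: "(\<Sum>c<D. bform K (N c) w w) = (\<Sum>a\<in>R. (w a)\<^sup>2)" for w
  proof -
    have "(\<Sum>c<D. bform K (N c) w w) = bform K B (T w) (T w)"
      unfolding NT B by (rule refl)
    also have "\<dots> = bform K (\<lambda>a a'. bform K B (b a) (b a')) w w"
      by (rule T)
    also have "\<dots> = (\<Sum>a<K. (if a \<in> R then 1 else 0) * w a * w a)"
      by (subst bform_diagonal) (auto simp: Bb)
    also have "\<dots> = (\<Sum>a\<in>R. (w a)\<^sup>2)"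
      using R by (intro sum.mono_neutral_cong_right) (auto simp: power2_eq_square)
    finally show ?thesis .
  qed
  have n5: "\<exists>l. (\<forall>c<D. \<bar>l c\<bar> \<le> 1) \<and> (\<Sum>c<D. l c) = 1 \<and> p i = (\<Sum>c<D. l c *\<^sub>R p (j c)) \<and>
      psd_form K (\<lambda>a b. \<Sum>c<D. l c * N c a b)" if i: "i \<in> S" for i
  proof -
    obtain l where l: "\<forall>c<D. \<bar>l c\<bar> \<le> 1" "\<And>x. x \<in> C \<Longrightarrow> u i x = (\<Sum>c<D. l c * u (j c) x)"
      using j(2) i by blast
    have l1: "(\<Sum>c<D. l c) = 1" using l(2)[of "Inr None"] by (auto simp: C_def u_def)
    have pi: "p i = (\<Sum>c<D. l c *\<^sub>R p (j c))"
    proof (rule euclidean_eqI)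
      fix e :: 'a assume "e \<in> Basis"
      then show "inner (p i) e = inner (\<Sum>c<D. l c *\<^sub>R p (j c)) e"
        using l(2)[of "Inr (Some e)"] by (auto simp: C_def u_def inner_sum_left)
    qed
    have "A i a b = (\<Sum>c<D. l c * A (j c) a b)" for a b
    proof (cases "(a, b) \<in> E")
      case True
      then show ?thesis using l(2)[of "Inl (a, b)"] by (auto simp: C_def u_def)
    next
      case False
      then have "A i a b = 0" "\<forall>c<D. A (j c) a b = 0"
        using data i sup unfolding lmi_data_def supported_sym_psd_def by blast+
      then show ?thesis by simp
    qed
    then have "(\<lambda>a b. \<Sum>c<D. l c * A (j c) a b) = A i" by (intro ext) simp
    then have "bform K (\<lambda>a b. \<Sum>c<D. l c * N c a b) w w = bform K (A i) (T w) (T w)" for w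
      unfolding sumT by simp
    moreover have "psd_form K (A i)"
      using data i unfolding lmi_data_def supported_sym_psd_def by blast
    ultimately have "psd_form K (\<lambda>a b. \<Sum>c<D. l c * N c a b)"
      unfolding psd_form_def by simp
    with l(1) l1 pi show ?thesis by blast
  qed
  have n6: "(\<Sum>c<D. m c *\<^sub>R p (j c)) \<in> P"
    if m: "(\<Sum>c<D. m c) = 1" and pos: "psd_form K (\<lambda>a b. \<Sum>c<D. m c * N c a b)" for m
  proof -
    have "0 \<le> bform K (\<lambda>a b. \<Sum>c<D. m c * A (j c) a b) v v" for v
    proof -
      \<comment> \<open>Expand \<open>v\<close> in the system: \<open>v\<close> is
        \<open>T w\<close> plus a null vector \<open>z\<close> of \<open>B\<close>. As
        \<open>z\<close> is null for every \<open>A (j c)\<close>, it contributes nothing, and only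
        the value at \<open>w\<close> in the new coordinates remains.\<close>
      define w where "w a = bform K B v (b a)" for a
      have Tw: "T w x = (\<Sum>a\<in>R. bform K B v (b a) * b a x)" for x
        unfolding T_def using R b0 by (intro sum.mono_neutral_cong_right) (auto simp: w_def)
      define z where "z x = v x - T w x" for x
      have Bz: "bform K B z z = 0"
        using res[of v] unfolding z_def[abs_def] Tw .
      have "bform K (A (j c)) v v = bform K (N c) w w" if c: "c < D" for c
      proof -
        have z0: "bform K (A (j c)) z z = 0"
          using psd_formD[OF psd[OF c], of z] le[OF c, of z] Bz by simp
        have Tz: "bform K (A (j c)) (T w) z = 0"
          by (rule psd_form_null[OF _ psd[OF c] z0]) (rule sym[OF c])
        have "bform K (A (j c)) (\<lambda>x. T w x + 1 * z x) (\<lambda>x. T w x + 1 * z x) =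
            bform K (A (j c)) (T w) (T w) +
            2 * 1 * bform K (A (j c)) (T w) z + 1\<^sup>2 * bform K (A (j c)) z z"
          by (rule bform_square_add) (rule sym[OF c])
        moreover have "(\<lambda>x. T w x + 1 * z x) = v" by (simp add: z_def)
        ultimately have "bform K (A (j c)) v v = bform K (A (j c)) (T w) (T w)"
          by (simp add: z0 Tz)
        then show ?thesis by (simp only: NT)
      qed
      then have "bform K (\<lambda>a b. \<Sum>c<D. m c * A (j c) a b) v v =
          bform K (\<lambda>a b. \<Sum>c<D. m c * N c a b) w w"
        by (simp add: bform_matrix_sum)
      then show ?thesis using psd_formD[OF pos] by simp
    qed
    then show ?thesis using data j(1) m by (simp add: lmi_data_def psd_form_def)
  qed
  have "normal_form K E D p S P j N"
    unfolding normal_form_def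
  proof (intro conjI)
    show "\<forall>c<D. \<forall>a b. \<bar>N c a b\<bar> \<le> 1 \<and> ((a, b) \<notin> E \<longrightarrow> N c a b = 0)"
      using n1 n2 by simp
    show "\<exists>R\<subseteq>{..<K}. (\<forall>c<D. \<forall>a b. a \<notin> R \<or> b \<notin> R \<longrightarrow> N c a b = 0) \<and>
        (\<forall>w. (\<Sum>c<D. bform K (N c) w w) = (\<Sum>a\<in>R. (w a)\<^sup>2))"
      using R n3 n4 by (intro exI[of _ R] conjI) simp_all
  qed (use j(1) n5 n6 in simp_all)
  then show ?thesis using that unfolding D_def by blast
qed

section \<open>Perturbation of normal forms\<close>

text \<open>The factor \<open>K\<close> comes from Cauchy-Schwarz: the square of the sum of the
  \<open>\<bar>w a\<bar>\<close> is at most \<open>K\<close> times the sum of squares.\<close>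

lemma bform_abs_le:
  assumes "\<And>a b. \<bar>F a b\<bar> \<le> e" and "0 \<le> e"
  shows "\<bar>bform K F w w\<bar> \<le> e * K * (\<Sum>a<K. (w a)\<^sup>2)"
proof -
  have "\<bar>bform K F w w\<bar> \<le> (\<Sum>a<K. \<Sum>b<K. \<bar>F a b * w a * w b\<bar>)"
    unfolding bform_def by (intro order_trans[OF sum_abs] sum_mono) simp
  also have "\<dots> \<le> (\<Sum>a<K. \<Sum>b<K. e * (\<bar>w a\<bar> * \<bar>w b\<bar>))"
    using assms by (intro sum_mono) (simp add: abs_mult mult.assoc mult_right_mono)
  also have "\<dots> = e * (\<Sum>a<K. \<bar>w a\<bar>)\<^sup>2"
    unfolding power2_eq_square sum_product by (simp add: sum_distrib_left)
  also have "\<dots> \<le> e * ((\<Sum>a<K. \<bar>w a\<bar>\<^sup>2) * card {..<K})"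
    using assms(2) by (intro mult_left_mono sum_squared_le_sum_of_squares) auto
  finally show ?thesis by (simp add: mult_ac)
qed

text \<open>
  The affine combination that represents \<open>p i\<close> in the first normal form becomes semidefinite for the
  second one after mixing in a small multiple of the centre, so \<open>P'\<close> has a point close to \<open>p i\<close>.
\<close>

lemma normal_forms_close:
  fixes p :: "'i \<Rightarrow> 'a::euclidean_space"
  assumes nf: "normal_form K E D p S P j N" and nf': "normal_form K E D p S' P' j' N'"
    and jj: "\<And>c. c < D \<Longrightarrow> j' c = j c"
    and close: "\<And>c a b. c < D \<Longrightarrow> (a, b) \<in> E \<Longrightarrow> \<bar>N c a b - N' c a b\<bar> \<le> e" and e: "0 \<le> e"
    and i: "i \<in> S" and hi: "inner u (p i) + t = 0"
    and H: "\<And>s. s \<in> S \<Longrightarrow> inner u (p s) + t \<le> H"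
    and small: "real D ^ 2 * real K * e * H \<le> 1"
  shows "\<exists>x\<in>P'. inner u x + t < 1"
proof -
  \<comment> \<open>A bound for the quadratic form of the rounding error on unit vectors:
    coefficients in [-1, 1] give entry errors up to \<open>D * e\<close>, and
    \<open>bform_abs_le\<close> adds the factor \<open>K\<close>.\<close>
  define T where "T = real D * real K * e"
  have T0: "0 \<le> T" using e by (simp add: T_def)
  have "\<forall>i\<in>S. \<exists>l. (\<forall>c<D. \<bar>l c\<bar> \<le> 1) \<and> (\<Sum>c<D. l c) = 1 \<and>
      p i = (\<Sum>c<D. l c *\<^sub>R p (j c)) \<and> psd_form K (\<lambda>a b. \<Sum>c<D. l c * N c a b)"
    using nf unfolding normal_form_def by (elim conjE)
  from bspec[OF this i] obtain l where l: "\<forall>c<D. \<bar>l c\<bar> \<le> 1" "(\<Sum>c<D. l c) = 1"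
      "p i = (\<Sum>c<D. l c *\<^sub>R p (j c))"
    and lpsd: "psd_form K (\<lambda>a b. \<Sum>c<D. l c * N c a b)"
    by (elim exE conjE)
  have "\<exists>R\<subseteq>{..<K}. (\<forall>c<D. \<forall>a b. a \<notin> R \<or> b \<notin> R \<longrightarrow> N' c a b = 0) \<and>
      (\<forall>w. (\<Sum>c<D. bform K (N' c) w w) = (\<Sum>a\<in>R. (w a)\<^sup>2))"
    using nf' unfolding normal_form_def by (elim conjE)
  then obtain R where R: "R \<subseteq> {..<K}" "\<forall>c<D. \<forall>a b. a \<notin> R \<or> b \<notin> R \<longrightarrow> N' c a b = 0"
    "\<forall>w. (\<Sum>c<D. bform K (N' c) w w) = (\<Sum>a\<in>R. (w a)\<^sup>2)"
    by (elim exE conjE)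
  have offE: "N c a b = 0" "N' c a b = 0" if "c < D" "(a, b) \<notin> E" for c a b
  proof -
    have "\<forall>c<D. \<forall>a b. \<bar>N c a b\<bar> \<le> 1 \<and> ((a, b) \<notin> E \<longrightarrow> N c a b = 0)"
      using nf unfolding normal_form_def by (elim conjE)
    then show "N c a b = 0" using that by simp
    have "\<forall>c<D. \<forall>a b. \<bar>N' c a b\<bar> \<le> 1 \<and> ((a, b) \<notin> E \<longrightarrow> N' c a b = 0)"
      using nf' unfolding normal_form_def by (elim conjE)
    then show "N' c a b = 0" using that by simp
  qed
  have near: "\<bar>\<Sum>c<D. l c * (N' c a b - N c a b)\<bar> \<le> real D * e" for a b
  proof -
    have "\<bar>l c * (N' c a b - N c a b)\<bar> \<le> 1 * e" if c: "c < D" for c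
    proof -
      have "\<bar>N' c a b - N c a b\<bar> \<le> e"
        using close[OF c, of a b] offE[OF c, of a b] e by (cases "(a, b) \<in> E") auto
      then show ?thesis unfolding abs_mult using l(1) c by (intro mult_mono) auto
    qed
    then have "(\<Sum>c<D. \<bar>l c * (N' c a b - N c a b)\<bar>) \<le> (\<Sum>c<D. e)"
      by (intro sum_mono) auto
    then show ?thesis by (intro order_trans[OF sum_abs]) simp
  qed
  have mix: "psd_form K (\<lambda>a b. \<Sum>c<D. (l c + T) * N' c a b)"
    unfolding psd_form_def
  proof
    fix v :: "nat \<Rightarrow> real"
    \<comment> \<open>The matrices \<open>N' c\<close> see only the coordinates in \<open>R\<close>,
      and there the added multiple \<open>T\<close> of their sum is \<open>T\<close> times the
      identity, enough to outweigh the error.\<close>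
    define w where "w a = (if a \<in> R then v a else 0)" for a
    have vw: "bform K (N' c) v v = bform K (N' c) w w" if "c < D" for c
      unfolding bform_def w_def using R(2) that by (intro sum.cong refl) auto
    have "bform K (\<lambda>a b. \<Sum>c<D. l c * (N' c a b - N c a b)) w w =
        (\<Sum>c<D. l c * bform K (N' c) w w) - bform K (\<lambda>a b. \<Sum>c<D. l c * N c a b) w w"
      unfolding bform_matrix_sum[symmetric]
      by (simp add: bform_def right_diff_distrib left_diff_distrib sum_subtractf)
    moreover have "\<bar>bform K (\<lambda>a b. \<Sum>c<D. l c * (N' c a b - N c a b)) w w\<bar> \<le>
        real D * e * K * (\<Sum>a<K. (w a)\<^sup>2)"
      using near e by (intro bform_abs_le) auto
    moreover have "(\<Sum>a<K. (w a)\<^sup>2) = (\<Sum>a\<in>R. (v a)\<^sup>2)"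
      using R(1) by (intro sum.mono_neutral_cong_right) (auto simp: w_def)
    ultimately have "(\<Sum>c<D. l c * bform K (N' c) w w) \<ge> - (T * (\<Sum>a\<in>R. (v a)\<^sup>2))"
      using psd_formD[OF lpsd, of w] by (simp add: T_def mult_ac)
    moreover have "bform K (\<lambda>a b. \<Sum>c<D. (l c + T) * N' c a b) v v =
        (\<Sum>c<D. l c * bform K (N' c) w w) + T * (\<Sum>a\<in>R. (v a)\<^sup>2)"
      unfolding bform_matrix_sum R(3)[rule_format, symmetric] sum_distrib_left
      using vw by (simp add: distrib_right sum.distrib)
    ultimately show "0 \<le> bform K (\<lambda>a b. \<Sum>c<D. (l c + T) * N' c a b) v v" by simp
  qed
  \<comment> \<open>The sum of the shifted coefficients \<open>l c + T\<close>; dividing by it makes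
    the combination affine again.\<close>
  define q where "q = 1 + T * real D"
  have q: "q > 0" using T0 by (simp add: q_def add_pos_nonneg)
  define m where "m c = (l c + T) / q" for c
  have m1: "(\<Sum>c<D. m c) = 1"
    using l(2) q by (simp add: m_def sum.distrib q_def mult.commute flip: sum_divide_distrib)
  have "(\<lambda>a b. \<Sum>c<D. m c * N' c a b) = (\<lambda>a b. (1 / q) * (\<Sum>c<D. (l c + T) * N' c a b))"
    by (simp add: m_def sum_divide_distrib)
  then have "psd_form K (\<lambda>a b. \<Sum>c<D. m c * N' c a b)"
    using mix q unfolding psd_form_def by (simp only: bform_matrix_scale) auto
  then have "(\<Sum>c<D. m c *\<^sub>R p (j' c)) \<in> P'"
    using nf' m1 unfolding normal_form_def by (elim conjE) simp
  then have "(\<Sum>c<D. m c *\<^sub>R p (j c)) \<in> P'" (is "?x \<in> _")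
    using jj by simp
  define h where "h x = inner u x + t" for x
  have comb: "h (\<Sum>c<D. k c *\<^sub>R p (j c)) = (\<Sum>c<D. k c * h (p (j c)))" if "(\<Sum>c<D. k c) = 1" for k
    using that by (simp add: h_def inner_sum_right distrib_left sum.distrib flip: sum_distrib_right)
  have jS: "\<forall>c<D. j c \<in> S" using nf unfolding normal_form_def by (elim conjE)
  have hD: "(\<Sum>c<D. h (p (j c))) \<le> real D * H"
    using sum_mono[of "{..<D}" "\<lambda>c. h (p (j c))" "\<lambda>_. H"] H jS
    by (auto simp: h_def)
  have "h ?x = (\<Sum>c<D. m c * h (p (j c)))" using comb[OF m1] .
  also have "\<dots> = ((\<Sum>c<D. l c * h (p (j c))) + T * (\<Sum>c<D. h (p (j c)))) / q"
    by (simp add: m_def distrib_right sum.distrib sum_distrib_left flip: sum_divide_distrib)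
  also have "(\<Sum>c<D. l c * h (p (j c))) = h (p i)" using comb[OF l(2)] l(3) by simp
  also have "h (p i) = 0" using hi by (simp add: h_def)
  also have "(0 + T * (\<Sum>c<D. h (p (j c)))) / q \<le> T * (real D * H) / q"
    using T0 q hD by (intro divide_right_mono) (auto intro: mult_left_mono)
  also have "T * (real D * H) / q < 1"
  \<comment> \<open>For positive \<open>T * real D\<close> the numerator is at most 1 and
    \<open>q\<close> exceeds 1; otherwise the numerator is 0.\<close>
  proof (cases "T * real D = 0")
    case True
    then have "T * (real D * H) = 0" by auto
    then show ?thesis by (simp only: div_0 zero_less_one)
  next
    case False
    have "real D ^ 2 * real K * e * H = T * (real D * H)"
      by (simp add: T_def power2_eq_square)
    with small have "T * (real D * H) \<le> 1" by simp
    moreover have "0 < T * real D"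
      using False mult_nonneg_nonneg[OF T0, of "real D"] by linarith
    ultimately have "T * (real D * H) < q" by (simp add: q_def)
    then show ?thesis using q by simp
  qed
  finally have "h ?x < 1" .
  then show ?thesis using \<open>?x \<in> P'\<close> by (auto simp: h_def)
qed

section \<open>From extended formulations to matrices at finitely many points\<close>

lemma linear_vec_comb:
  fixes x :: "nat \<Rightarrow> real Matrix.vec" and L :: "real Matrix.vec \<Rightarrow> 'b::real_vector"
  assumes add: "\<forall>x\<in>carrier_vec q. \<forall>y\<in>carrier_vec q. L (x + y) = L x + L y"
    and scale: "\<forall>a. \<forall>x\<in>carrier_vec q. L (a \<cdot>\<^sub>v x) = a *\<^sub>R L x"
    and x: "\<forall>c<D. x c \<in> carrier_vec q"
  shows "L (Matrix.vec q (\<lambda>t. \<Sum>c<D. m c * vec_index (x c) t)) = (\<Sum>c<D. m c *\<^sub>R L (x c))"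
  using x
proof (induction D)
  case 0
  \<comment> \<open>Additivity and homogeneity are assumed on the carrier only; \<open>L\<close> of
    the zero vector is 0 by scaling with 0.\<close>
  have "Matrix.vec q (\<lambda>t. 0 :: real) = 0 \<cdot>\<^sub>v Matrix.vec q (\<lambda>t. 0)" by auto
  then have "L (Matrix.vec q (\<lambda>t. 0)) = 0 *\<^sub>R L (Matrix.vec q (\<lambda>t. 0))"
    using scale by (metis vec_carrier)
  then show ?case by simp
next
  case (Suc D)
  define y where "y = Matrix.vec q (\<lambda>t. \<Sum>c<D. m c * vec_index (x c) t)"
  have xD: "x D \<in> carrier_vec q" using Suc.prems by simp
  have "Matrix.vec q (\<lambda>t. \<Sum>c<Suc D. m c * vec_index (x c) t) = y + m D \<cdot>\<^sub>v x D"
    using xD by (intro eq_vecI) (auto simp: y_def)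
  also have "L \<dots> = L y + L (m D \<cdot>\<^sub>v x D)"
    using xD by (intro add[rule_format]) (auto simp: y_def)
  also have "L (m D \<cdot>\<^sub>v x D) = m D *\<^sub>R L (x D)" using scale xD by blast
  also have "L y = (\<Sum>c<D. m c *\<^sub>R L (x c))"
    unfolding y_def using Suc.prems by (intro Suc.IH) simp
  finally show ?case by simp
qed

text \<open>Coefficients of sum 1 reproduce the constant part of the affine map.\<close>

lemma affine_map_on_comb:
  assumes f: "affine_map_on q f" and x: "\<forall>c<D. x c \<in> carrier_vec q" and m: "(\<Sum>c<D. m c) = 1"
  shows "f (Matrix.vec q (\<lambda>t. \<Sum>c<D. m c * vec_index (x c) t)) = (\<Sum>c<(D::nat). m c *\<^sub>R f (x c))"
proof -
  obtain L b where L: "\<forall>x\<in>carrier_vec q. \<forall>y\<in>carrier_vec q. L (x + y) = L x + L y"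
      "\<forall>a. \<forall>x\<in>carrier_vec q. L (a \<cdot>\<^sub>v x) = a *\<^sub>R L x"
      "\<forall>x\<in>carrier_vec q. f x = L x + b"
    using f unfolding affine_map_on_def by blast
  have "f (Matrix.vec q (\<lambda>t. \<Sum>c<D. m c * vec_index (x c) t)) = (\<Sum>c<D. m c *\<^sub>R L (x c)) + b"
    using linear_vec_comb[OF L(1,2) x] L(3) by simp
  also have "\<dots> = (\<Sum>c<D. m c *\<^sub>R L (x c)) + (\<Sum>c<D. m c) *\<^sub>R b" using m by simp
  also have "\<dots> = (\<Sum>c<D. m c *\<^sub>R (L (x c) + b))"
    by (simp only: scaleR_sum_left scaleR_add_right sum.distrib)
  also have "\<dots> = (\<Sum>c<D. m c *\<^sub>R f (x c))" using x L(3) by simp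
  finally show ?thesis .
qed

text \<open>Padding with zeros does not change the values of the form. Thus formulations of various
  sizes can share one \<open>K\<close>.\<close>

lemma psd_mats_iff:
  assumes M: "M \<in> sym_mats k" and kK: "k \<le> K"
    and F: "\<And>a b. F a b = (if a < k \<and> b < k then M $$ (a, b) else 0)"
  shows "M \<in> psd_mats k \<longleftrightarrow> psd_form K F"
proof -
  have dim: "M \<in> carrier_mat k k" using M by (simp add: sym_mats_def)
  have form: "bform K F w w = scalar_prod v (M *\<^sub>v v)"
    if v: "v \<in> carrier_vec k" and w: "\<And>a. a < k \<Longrightarrow> w a = vec_index v a" for v w
  proof -
    have "bform K F w w = (\<Sum>a<K. \<Sum>b<k. F a b * w a * w b)"
      unfolding bform_def using kK by (intro sum.cong refl sum.mono_neutral_right) (auto simp: F)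
    also have "\<dots> = (\<Sum>a<k. \<Sum>b<k. F a b * w a * w b)"
      using kK by (intro sum.mono_neutral_right) (auto simp: F)
    also have "\<dots> = (\<Sum>a<k. vec_index v a * (\<Sum>b<k. M $$ (a, b) * vec_index v b))"
      unfolding sum_distrib_left by (intro sum.cong refl) (simp add: F w)
    also have "\<dots> = scalar_prod v (M *\<^sub>v v)"
      using dim v by (auto simp: scalar_prod_def atLeast0LessThan intro!: sum.cong)
    finally show ?thesis .
  qed
  show ?thesis
  proof
    assume "M \<in> psd_mats k"
    then have "0 \<le> bform K F w w" for w
      using form[of "Matrix.vec k w" w] unfolding psd_mats_def by simp
    then show "psd_form K F" by (simp add: psd_form_def)
  next
    assume "psd_form K F"
    then have "0 \<le> scalar_prod v (M *\<^sub>v v)" if "v \<in> carrier_vec k" for v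
      using form[OF that, of "vec_index v"] by (metis psd_formD)
    then show "M \<in> psd_mats k" using M by (simp add: psd_mats_def)
  qed
qed

text \<open>\<open>\<phi>\<close> and the entries of \<open>M\<close> commute with affine
  combinations of the chosen preimages. If the combined matrix is semidefinite, the combined
  preimage is feasible and its image lies in \<open>P\<close>.\<close>

lemma ext_formulation_lmi_data:
  fixes p :: "'i \<Rightarrow> 'a::euclidean_space"
  assumes ef: "ext_formulation q k \<phi> M P" and kK: "k \<le> K" and p: "\<forall>i\<in>S. p i \<in> P"
    and E: "\<And>x a b. x \<in> carrier_vec q \<Longrightarrow> a < k \<Longrightarrow> b < k \<Longrightarrow> (a, b) \<notin> E \<Longrightarrow> M x $$ (a, b) = 0"
  shows "\<exists>A. lmi_data K E p S P A"
proof -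
  note ef' = ef[unfolded ext_formulation_def affine_sym_map_on_def]
  from ef' have phi: "affine_map_on q \<phi>" by (elim conjE)
  from ef' have Msym: "\<forall>x\<in>carrier_vec q. M x \<in> sym_mats k" by (elim conjE)
  from ef' have Maff: "\<forall>a<k. \<forall>b<k. affine_map_on q (\<lambda>x. M x $$ (a, b))" by (elim conjE)
  from ef' have P: "P = \<phi> ` {x \<in> carrier_vec q. M x \<in> psd_mats k}" by (elim conjE)
  have "\<forall>i\<in>S. \<exists>x. x \<in> carrier_vec q \<and> M x \<in> psd_mats k \<and> \<phi> x = p i"
  proof
    fix i assume "i \<in> S"
    then have "p i \<in> \<phi> ` {x \<in> carrier_vec q. M x \<in> psd_mats k}"
      using bspec[OF p] unfolding P by simp
    then obtain x where "p i = \<phi> x" "x \<in> {x \<in> carrier_vec q. M x \<in> psd_mats k}"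
      by (rule imageE)
    then show "\<exists>x. x \<in> carrier_vec q \<and> M x \<in> psd_mats k \<and> \<phi> x = p i" by auto
  qed
  from bchoice[OF this] obtain x
    where x: "\<forall>i\<in>S. x i \<in> carrier_vec q \<and> M (x i) \<in> psd_mats k \<and> \<phi> (x i) = p i"
    by (rule exE)
  define A where "A i a b = (if a < k \<and> b < k then M (x i) $$ (a, b) else 0)" for i a b
  have "supported_sym_psd K E (A i)" if i: "i \<in> S" for i
    unfolding supported_sym_psd_def
  proof (intro conjI allI impI)
    have xi: "x i \<in> carrier_vec q" using x i by blast
    have M: "M (x i) \<in> carrier_mat k k" "transpose_mat (M (x i)) = M (x i)"
      using bspec[OF Msym xi] by (auto simp: sym_mats_def)
    show "A i a b = A i b a" for a b
    proof (cases "a < k \<and> b < k")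
      case True
      then have "transpose_mat (M (x i)) $$ (a, b) = M (x i) $$ (b, a)" using M(1) by simp
      with M(2) True show ?thesis by (simp add: A_def)
    qed (auto simp: A_def)
    show "psd_form K (A i)"
      using psd_mats_iff[OF bspec[OF Msym xi] kK, of "A i"] x i by (simp add: A_def)
    show "A i a b = 0" if "(a, b) \<notin> E" for a b
      using E[OF xi _ _ that] by (simp add: A_def)
  qed
  moreover have "(\<Sum>c<D. m c *\<^sub>R p (j c)) \<in> P"
    if j: "\<forall>c<D. j c \<in> S" and m: "(\<Sum>c<D. m c) = 1"
      and psd: "psd_form K (\<lambda>a b. \<Sum>c<D. m c * A (j c) a b)" for D :: nat and j m
  proof -
    define y where "y = Matrix.vec q (\<lambda>t. \<Sum>c<D. m c * vec_index (x (j c)) t)"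
    have y: "y \<in> carrier_vec q" by (simp add: y_def)
    have xj: "\<forall>c<D. x (j c) \<in> carrier_vec q" using x j by blast
    have "\<phi> y = (\<Sum>c<D. m c *\<^sub>R \<phi> (x (j c)))"
      unfolding y_def by (rule affine_map_on_comb[OF phi xj m])
    also have "\<dots> = (\<Sum>c<D. m c *\<^sub>R p (j c))" using x j by simp
    finally have py: "\<phi> y = (\<Sum>c<D. m c *\<^sub>R p (j c))" .
    have "(\<Sum>c<D. m c * A (j c) a b) = (if a < k \<and> b < k then M y $$ (a, b) else 0)" for a b
    proof (cases "a < k \<and> b < k")
      case True
      then have "M y $$ (a, b) = (\<Sum>c<D. m c *\<^sub>R M (x (j c)) $$ (a, b))"
        unfolding y_def by (intro affine_map_on_comb[OF Maff[rule_format] xj m]) auto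
      with True show ?thesis by (simp add: A_def)
    qed (auto simp: A_def)
    then have "M y \<in> psd_mats k"
      using psd_mats_iff[OF bspec[OF Msym y] kK, of "\<lambda>a b. \<Sum>c<D. m c * A (j c) a b"] psd by blast
    with y have "\<phi> y \<in> P" unfolding P by (intro imageI) simp
    then show ?thesis using py by simp
  qed
  ultimately show ?thesis unfolding lmi_data_def by (intro exI[of _ A]) blast
qed

lemma lmi_formulation_data:
  assumes "has_lmi_formulation P k" and "k \<le> K" and "\<forall>i\<in>S. p i \<in> P"
  shows "\<exists>A. lmi_data K ({..<K} \<times> {..<K}) p S P A"
proof -
  obtain q \<phi> M where ef: "ext_formulation q k \<phi> M P"
    using assms(1) unfolding has_lmi_formulation_def by blast
  show ?thesis
    by (rule ext_formulation_lmi_data[OF ef assms(2,3)]) (use assms(2) in auto)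
qed

lemma linear_formulation_data:
  assumes "has_linear_formulation P k" and "k \<le> K" and "\<forall>i\<in>S. p i \<in> P"
  shows "\<exists>A. lmi_data K ((\<lambda>a. (a, a)) ` {..<K}) p S P A"
proof -
  obtain q \<phi> M where ef: "ext_formulation q k \<phi> M P"
    and diag: "\<forall>x\<in>carrier_vec q. diagonal_mat (M x)"
    using assms(1) unfolding has_linear_formulation_def by blast
  show ?thesis
  proof (rule ext_formulation_lmi_data[OF ef assms(2,3)])
    fix x :: "real Matrix.vec" and a b :: nat
    assume x: "x \<in> carrier_vec q" and ab: "a < k" "b < k"
      and "(a, b) \<notin> (\<lambda>a. (a, a)) ` {..<K}"
    then have "a \<noteq> b" using assms(2) by auto
    moreover have "\<forall>x\<in>carrier_vec q. M x \<in> sym_mats k"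
      using ef unfolding ext_formulation_def affine_sym_map_on_def by (elim conjE)
    then have "M x \<in> carrier_mat k k"
      using x unfolding sym_mats_def by blast
    moreover have "\<forall>a<dim_row (M x). \<forall>b<dim_col (M x). a \<noteq> b \<longrightarrow> M x $$ (a, b) = 0"
      using diag x unfolding diagonal_mat_def by blast
    ultimately show "M x $$ (a, b) = 0"
      using ab by simp
  qed
qed

subsection \<open>Polygons inscribed in a parabola\<close>

definition parabola_point :: "nat \<Rightarrow> real^2" where
  "parabola_point i = vector [real i, real (i\<^sup>2)]"

text \<open>Together with the constant \<open>(real i)\<^sup>2\<close> this normal yields the signed
  vertical distance from the tangent at \<open>parabola_point i\<close>.\<close>

definition tangent_normal :: "nat \<Rightarrow> real^2" where
  "tangent_normal i = vector [- 2 * real i, 1]"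

lemma tangent_gap: "inner (tangent_normal i) (parabola_point j) + (real i)\<^sup>2 = (real j - real i)\<^sup>2"
  by (simp add: tangent_normal_def parabola_point_def inner_vec_def sum_2 power2_eq_square
      algebra_simps)

lemma tangent_gap_ge_1:
  assumes "i \<noteq> j"
  shows "1 \<le> inner (tangent_normal i) (parabola_point j) + (real i)\<^sup>2"
proof -
  have "1 \<le> \<bar>real j - real i\<bar>" using assms by linarith
  then show ?thesis
    unfolding tangent_gap using power_mono[of 1 "\<bar>real j - real i\<bar>" 2] by simp
qed

lemma inj_parabola_point: "inj parabola_point"
proof (rule injI)
  fix i j assume "parabola_point i = parabola_point j"
  then have "inner (tangent_normal i) (parabola_point j) + (real i)\<^sup>2 =
      inner (tangent_normal i) (parabola_point i) + (real i)\<^sup>2" by simp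
  then show "i = j" using tangent_gap_ge_1[of i j] tangent_gap[of i i] by force
qed

definition parabola_hull :: "nat set \<Rightarrow> (real^2) set" where
  "parabola_hull S = convex hull (parabola_point ` S)"

lemma parabola_point_in_hull: "i \<in> S \<Longrightarrow> parabola_point i \<in> parabola_hull S"
  unfolding parabola_hull_def by (intro hull_inc imageI)

lemma parabola_hull_above:
  assumes "x \<in> parabola_hull S" and "\<And>j. j \<in> S \<Longrightarrow> b \<le> inner (tangent_normal i) (parabola_point j)"
  shows "b \<le> inner (tangent_normal i) x"
proof -
  have "parabola_hull S \<subseteq> {x. inner (tangent_normal i) x \<ge> b}"
    unfolding parabola_hull_def
    by (rule hull_minimal) (use assms(2) in \<open>auto simp: convex_halfspace_ge\<close>)
  then show ?thesis using assms(1) by blast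
qed

lemma parabola_hull_gap_ge_1:
  assumes "x \<in> parabola_hull S" and "i \<notin> S"
  shows "1 \<le> inner (tangent_normal i) x + (real i)\<^sup>2"
proof -
  have "1 - (real i)\<^sup>2 \<le> inner (tangent_normal i) (parabola_point j)" if "j \<in> S" for j
    using tangent_gap_ge_1[of i j] assms(2) that by force
  from parabola_hull_above[OF assms(1) this] show ?thesis by simp
qed

lemma parabola_hull_gap_ge_0:
  assumes "x \<in> parabola_hull S"
  shows "0 \<le> inner (tangent_normal i) x + (real i)\<^sup>2"
proof -
  have "- (real i)\<^sup>2 \<le> inner (tangent_normal i) (parabola_point j)" for j
    using tangent_gap[of i j] zero_le_power2[of "real j - real i"] by linarith
  from parabola_hull_above[OF assms(1) this] show ?thesis by simp
qed

text \<open>The tangent at a point separates it from the hull of the others: its own gap is 0,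
  theirs is at least 1. So the points are convexly independent.\<close>

lemma vertices_parabola_hull:
  assumes "finite S"
  shows "vertices (parabola_hull S) = parabola_point ` S"
proof -
  have indep: "a \<notin> convex hull (parabola_point ` S - {a})" if a: "a \<in> parabola_point ` S" for a
  proof
    assume hull: "a \<in> convex hull (parabola_point ` S - {a})"
    obtain i where i: "a = parabola_point i" using a by blast
    have "parabola_point ` S - {a} = parabola_point ` (S - {i})"
      using inj_parabola_point by (auto simp: i inj_def)
    then have "a \<in> parabola_hull (S - {i})" using hull by (simp add: parabola_hull_def)
    then show False
      using parabola_hull_gap_ge_1[of a "S - {i}" i] tangent_gap[of i i] by (simp add: i)
  qed
  have "compact (parabola_point ` S)" using assms by (simp add: finite_imp_compact)
  then show ?thesis
    unfolding vertices_def parabola_hull_def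
    using extreme_point_of_convex_hull_convex_independent[OF _ indep] by auto
qed

section \<open>The family of index sets\<close>

definition index_sets :: "nat \<Rightarrow> nat set set" where
  "index_sets n = {S. S \<subseteq> {1..n\<^sup>2} \<and> card S = n}"

lemma index_setsD:
  assumes "S \<in> index_sets n"
  shows "S \<subseteq> {1..n\<^sup>2}" and "card S = n" and "finite S"
  using assms finite_subset[of S "{1..n\<^sup>2}"] by (auto simp: index_sets_def)

lemma index_set_exists: "{1..n} \<in> index_sets n"
proof -
  have "n \<le> n\<^sup>2" by (simp add: power2_eq_square)
  then show ?thesis by (auto simp: index_sets_def)
qed

text \<open>Uses that the binomial coefficient \<open>n\<^sup>2 choose n\<close> is at least the
  \<open>n\<close>-th power of \<open>n\<^sup>2 / n\<close>.\<close>

lemma card_index_sets_ge: "n ^ n \<le> card (index_sets n)"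
proof (cases "n = 0")
  case True
  moreover have "index_sets 0 = {{}}" by (auto simp: index_sets_def)
  ultimately show ?thesis by simp
next
  case False
  have "n \<le> n\<^sup>2" by (simp add: power2_eq_square)
  then have "(real (n\<^sup>2) / real n) ^ n \<le> real (n\<^sup>2 choose n)"
    by (rule binomial_ge_n_over_k_pow_k)
  moreover have "real (n\<^sup>2) / real n = real n" using False by (simp add: power2_eq_square)
  ultimately have "real (n ^ n) \<le> real (n\<^sup>2 choose n)" by simp
  moreover have "card (index_sets n) = (n\<^sup>2 choose n)"
    unfolding index_sets_def using n_subsets[of "{1..n\<^sup>2}" n] by simp
  ultimately show ?thesis by (simp only: of_nat_le_iff)
qed

lemma parabola_hull_in_grid_polygons:
  assumes S: "S \<in> index_sets n"
  shows "parabola_hull S \<in> grid_polygons n"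
proof -
  have "parabola_point ` S \<subseteq> grid (n^2) (n^4)"
  proof
    fix x assume "x \<in> parabola_point ` S"
    then obtain i where i: "x = parabola_point i" "1 \<le> i" "i \<le> n\<^sup>2"
      using index_setsD(1)[OF S] by auto
    have "i\<^sup>2 \<le> (n\<^sup>2)\<^sup>2" using i(3) by (rule power_mono) simp
    then have "i\<^sup>2 \<le> n ^ 4" by simp
    then show "x \<in> grid (n^2) (n^4)"
      unfolding grid_def i(1) parabola_point_def using i(2,3)
      by (intro CollectI exI[of _ i] exI[of _ "i\<^sup>2"]) auto
  qed
  moreover have "card (vertices (parabola_hull S)) = n"
    unfolding vertices_parabola_hull[OF index_setsD(3)[OF S]]
    using index_setsD(2)[OF S] inj_parabola_point by (subst card_image) (auto intro: inj_on_subset)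
  ultimately show ?thesis
    unfolding grid_polygons_def polytopes_on_def parabola_hull_def by blast
qed

section \<open>Counting the codes of normal forms\<close>

text \<open>The first factor counts the spanner indices, the second the entries rounded to multiples
  of \<open>1 / m\<close>. The value of \<open>m\<close> makes this precision just fine enough for
  \<open>normal_forms_close\<close> with tangent gaps up to \<open>n ^ 4\<close>.\<close>

lemma card_index_sets_le:
  assumes nf: "\<And>S. S \<in> index_sets n \<Longrightarrow>
      \<exists>j N. normal_form K E D parabola_point S (parabola_hull S) j N"
    and finE: "finite E" and m: "m = D\<^sup>2 * K * n ^ 4" and pos: "0 < m"
  shows "card (index_sets n) \<le> (n\<^sup>2) ^ D * (2 * m + 1) ^ (D * card E)"
proof -
  obtain j N where jN: "\<And>S. S \<in> index_sets n \<Longrightarrow>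
      normal_form K E D parabola_point S (parabola_hull S) (j S) (N S)"
    using nf by metis
  define code where "code S = (restrict (j S) {..<D},
      \<lambda>(c, a, b)\<in>{..<D} \<times> E. \<lfloor>real m * N S c a b\<rfloor>)" for S
  define T where "T = ({..<D} \<rightarrow>\<^sub>E {1..n\<^sup>2}) \<times> (({..<D} \<times> E) \<rightarrow>\<^sub>E {- int m..int m})"
  have "code S \<in> T" if S: "S \<in> index_sets n" for S
  proof -
    have j: "\<forall>c<D. j S c \<in> S" and b: "\<forall>c<D. \<forall>a b. \<bar>N S c a b\<bar> \<le> 1 \<and> ((a, b) \<notin> E \<longrightarrow> N S c a b = 0)"
      using jN[OF S] unfolding normal_form_def by simp_all
    have "\<lfloor>real m * N S c a b\<rfloor> \<in> {- int m..int m}" if c: "c < D" for c a b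
    proof -
      have "\<bar>real m * N S c a b\<bar> \<le> real m * 1"
        unfolding abs_mult using b c by (intro mult_mono) auto
      then have "- real m \<le> real m * N S c a b" "real m * N S c a b \<le> real m" by auto
      then show ?thesis by (simp add: le_floor_iff floor_le_iff)
    qed
    then show ?thesis
      using j index_setsD(1)[OF S] by (auto simp: T_def code_def)
  qed
  then have sub: "code ` index_sets n \<subseteq> T" by blast
  have inj: "inj_on code (index_sets n)"
  proof (rule inj_onI, rule ccontr)
    fix S S' assume S: "S \<in> index_sets n" and S': "S' \<in> index_sets n"
      and eq: "code S = code S'" and ne: "S \<noteq> S'"
    \<comment> \<open>Both sets have \<open>n\<close> elements, so distinctness excludes
      inclusion.\<close>
    have "\<not> S \<subseteq> S'"
      using card_subset_eq[of S' S] index_setsD[OF S] index_setsD[OF S'] ne by auto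
    then obtain i where i: "i \<in> S" "i \<notin> S'" by blast
    have eq1: "restrict (j S) {..<D} = restrict (j S') {..<D}"
      and eq2: "(\<lambda>(c, a, b)\<in>{..<D} \<times> E. \<lfloor>real m * N S c a b\<rfloor>) =
        (\<lambda>(c, a, b)\<in>{..<D} \<times> E. \<lfloor>real m * N S' c a b\<rfloor>)"
      using eq unfolding code_def prod.inject by blast+
    have jj: "j S' c = j S c" if "c < D" for c
      using fun_cong[OF eq1, of c] that by simp
    have close: "\<bar>N S c a b - N S' c a b\<bar> \<le> 1 / real m" if "c < D" "(a, b) \<in> E" for c a b
    proof -
      have "\<lfloor>real m * N S c a b\<rfloor> = \<lfloor>real m * N S' c a b\<rfloor>"
        using fun_cong[OF eq2, of "(c, a, b)"] that by simp
      then have "\<bar>real m * N S c a b - real m * N S' c a b\<bar> \<le> 1" by linarith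
      then have "real m * \<bar>N S c a b - N S' c a b\<bar> \<le> 1"
        by (simp add: abs_mult flip: right_diff_distrib)
      then show ?thesis using pos by (simp add: field_simps)
    qed
    have gap0: "inner (tangent_normal i) (parabola_point i) + (real i)\<^sup>2 = 0"
      by (simp add: tangent_gap)
    have H: "inner (tangent_normal i) (parabola_point s) + (real i)\<^sup>2 \<le> real n ^ 4" if s: "s \<in> S" for s
    proof -
      have "s \<le> n\<^sup>2" "i \<le> n\<^sup>2" using s i index_setsD(1)[OF S] by auto
      then have "real s \<le> (real n)\<^sup>2" "real i \<le> (real n)\<^sup>2"
        by (metis of_nat_le_iff of_nat_power)+
      then have "\<bar>real s - real i\<bar> \<le> (real n)\<^sup>2" by linarith
      then have "\<bar>real s - real i\<bar>\<^sup>2 \<le> ((real n)\<^sup>2)\<^sup>2" by (rule power_mono) simp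
      then show ?thesis unfolding tangent_gap by simp
    qed
    have small: "real D ^ 2 * real K * (1 / real m) * real n ^ 4 \<le> 1"
      using pos unfolding m by simp
    have "\<exists>x\<in>parabola_hull S'. inner (tangent_normal i) x + (real i)\<^sup>2 < 1"
      by (rule normal_forms_close[OF jN[OF S] jN[OF S'] jj close _ i(1) gap0 H small]) auto
    then show False using parabola_hull_gap_ge_1[OF _ i(2)] by force
  qed
  have finT: "finite T" unfolding T_def using finE by (intro finite_cartesian_product finite_PiE) auto
  have "card (index_sets n) \<le> card T" by (rule card_inj_on_le[OF inj sub finT])
  also have "card T = (n\<^sup>2) ^ D * (2 * m + 1) ^ (D * card E)"
  proof -
    have "nat (int m + 1 + int m) = 2 * m + 1" by simp
    then show ?thesis
      unfolding T_def using finE by (simp add: card_cartesian_product card_PiE)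
  qed
  finally show ?thesis .
qed

text \<open>For larger \<open>n\<close>, each rounded entry has at most \<open>n ^ 7\<close>
  possible values, and the number of codes is a power of \<open>n\<close> with exponent below
  \<open>n\<close>, fewer than the \<open>n ^ n\<close> index sets.\<close>

lemma pattern_size_lower_bound:
  assumes data: "\<And>S. S \<in> index_sets n \<Longrightarrow>
      \<exists>A. lmi_data K E parabola_point S (parabola_hull S) A"
    and finE: "finite E" and stable: "pattern_stable K E"
    and K: "1 \<le> K" "K \<le> card E" and n: "1 \<le> n"
  shows "n \<le> 36 * (card E)\<^sup>2"
proof (rule ccontr)
  define e where "e = card E"
  assume "\<not> ?thesis"
  then have big: "36 * e\<^sup>2 < n" by (simp add: e_def)
  have e1: "1 \<le> e" using K by (simp add: e_def)
  \<comment> \<open>Two coordinates of the plane and the constant 1 are added to the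
    \<open>e\<close> matrix entries.\<close>
  define D where "D = e + 3"
  define m where "m = D\<^sup>2 * K * n ^ 4"
  have m0: "0 < m" using K n by (simp add: m_def D_def)
  have nf: "\<exists>j N. normal_form K E D parabola_point S (parabola_hull S) j N"
    if S: "S \<in> index_sets n" for S
  proof -
    obtain A where A: "lmi_data K E parabola_point S (parabola_hull S) A" using data[OF S] by blast
    have "S \<noteq> {}" using index_setsD(2)[OF S] n by auto
    then obtain j N
      where "normal_form K E (card E + DIM(real^2) + 1) parabola_point S (parabola_hull S) j N"
      by (rule normal_form_exists[OF A index_setsD(3)[OF S] _ finE stable])
    moreover have "card E + DIM(real^2) + 1 = D" by (simp add: D_def e_def)
    ultimately show ?thesis by (intro exI) simp
  qed
  have n36: "36 \<le> n"
  proof -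
    have "36 * 1 \<le> 36 * e\<^sup>2" using e1 by (intro mult_le_mono2) simp
    then show ?thesis using big by simp
  qed
  have D4: "D \<le> 4 * e" using e1 by (simp add: D_def)
  have "m \<le> n ^ 6"
  proof -
    have "m \<le> (4 * e)\<^sup>2 * e * n ^ 4"
      unfolding m_def using D4 K(2) by (intro mult_le_mono power_mono) (auto simp: e_def)
    also have "(4 * e)\<^sup>2 * e \<le> n\<^sup>2"
    proof -
      have "(4 * e)\<^sup>2 * e = 16 * (e\<^sup>2 * e)" by (simp add: power_mult_distrib)
      also have "\<dots> \<le> 36 * (e\<^sup>2 * (36 * e\<^sup>2))"
        using e1 by (intro mult_le_mono) (auto simp: power2_eq_square)
      also have "\<dots> = (36 * e\<^sup>2)\<^sup>2" by (simp add: power2_eq_square)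
      also have "\<dots> \<le> n\<^sup>2" using big by (intro power_mono) auto
      finally show ?thesis .
    qed
    also have "n\<^sup>2 * n ^ 4 = n ^ 6" by (simp flip: power_add)
    finally show ?thesis by simp
  qed
  moreover have "1 \<le> n ^ 6" using n by simp
  ultimately have "2 * m + 1 \<le> 3 * n ^ 6" by linarith
  also have "\<dots> \<le> n * n ^ 6" using n36 by (intro mult_le_mono1) simp
  finally have m7: "2 * m + 1 \<le> n ^ 7" by (simp add: power_Suc[symmetric] del: power_Suc)
  have "n ^ n \<le> (n\<^sup>2) ^ D * (2 * m + 1) ^ (D * card E)"
    using card_index_sets_ge[of n] card_index_sets_le[OF nf finE m_def m0] by simp
  also have "\<dots> \<le> (n\<^sup>2) ^ D * (n ^ 7) ^ (D * e)"
    using m7 by (intro mult_le_mono2) (auto simp: e_def intro: power_mono)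
  also have "\<dots> = n ^ (2 * D + 7 * (D * e))" by (simp only: power_mult power_add)
  also have "\<dots> < n ^ n"
  proof (rule power_strict_increasing)
    \<comment> \<open>Since \<open>D \<le> 4 * e\<close>, the exponent is at most (2 + 7) * 4 times
      \<open>e\<^sup>2\<close>: the source of the constant 36.\<close>
    have "2 * D + 7 * (D * e) \<le> 2 * (4 * e * e) + 7 * (4 * e * e)"
      using D4 e1 by (intro add_mono mult_le_mono2) (auto intro: order_trans[OF D4] mult_le_mono1)
    also have "\<dots> = 36 * e\<^sup>2" by (simp add: power2_eq_square)
    finally show "2 * D + 7 * (D * e) < n" using big by simp
    show "1 < n" using n36 by simp
  qed
  finally show False by simp
qed

section \<open>Bounds for the extension complexities\<close>

text \<open>For \<open>K = 0\<close> semidefiniteness is void, so the polygon would contain every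
  affine combination of its vertices. Reflecting the vertex \<open>i'\<close> in the vertex
  \<open>i\<close> gives a point below the tangent at \<open>i\<close>.\<close>

lemma lmi_data_size_pos:
  assumes data: "lmi_data K E parabola_point S (parabola_hull S) A" and "2 \<le> card S"
  shows "1 \<le> K"
proof (rule ccontr)
  assume "\<not> 1 \<le> K"
  then have "K = 0" by simp
  obtain i i' where i: "i \<in> S" "i' \<in> S" "i \<noteq> i'"
    using assms(2) card_le_Suc0_iff_eq[of S] by (metis card.infinite not_less_eq_eq numeral_2_eq_2 zero_le)
  define j where "j c = (if c = (0::nat) then i else i')" for c
  define m where "m c = (if c = (0::nat) then 2 else - 1 :: real)" for c
  have "\<forall>c<2. j c \<in> S" using i by (simp add: j_def)
  moreover have "(\<Sum>c<2. m c) = 1" by (simp add: m_def numeral_2_eq_2)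
  moreover have "psd_form K (\<lambda>a b. \<Sum>c<2. m c * A (j c) a b)"
    by (simp add: psd_form_def bform_def \<open>K = 0\<close>)
  ultimately have "(\<Sum>c<2. m c *\<^sub>R parabola_point (j c)) \<in> parabola_hull S"
    using data unfolding lmi_data_def by blast
  then have "2 *\<^sub>R parabola_point i - parabola_point i' \<in> parabola_hull S"
    by (simp add: m_def j_def numeral_2_eq_2)
  then have "0 \<le> inner (tangent_normal i) (2 *\<^sub>R parabola_point i - parabola_point i') + (real i)\<^sup>2"
    by (rule parabola_hull_gap_ge_0)
  then show False
    using tangent_gap[of i i] tangent_gap_ge_1[OF i(3)] by (simp add: inner_diff_right)
qed

text \<open>Two distinct vertices exclude the special case of value 0, and the least size is
  attained because formulations exist.\<close>

lemma parabola_hull_sizes: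
  assumes "2 \<le> card S"
  shows "has_lmi_formulation (parabola_hull S) (sxc (parabola_hull S))"
    and "has_linear_formulation (parabola_hull S) (xc (parabola_hull S))"
proof -
  have fin: "finite S" using assms by (metis card.infinite not_numeral_le_zero)
  have ne: "parabola_hull S \<noteq> {}" using assms by (auto simp: parabola_hull_def)
  have not_single: "\<not> (\<exists>p. parabola_hull S = {p})"
  proof
    assume "\<exists>p. parabola_hull S = {p}"
    then obtain p where "parabola_hull S = {p}" by blast
    then have "parabola_point ` S \<subseteq> {p}" using parabola_point_in_hull by blast
    then have "card (parabola_point ` S) \<le> 1" using card_mono[of "{p}"] by fastforce
    moreover have "card (parabola_point ` S) = card S"
      using inj_parabola_point by (intro card_image) (auto intro: inj_on_subset)
    ultimately show False using assms by simp
  qed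
  have "polytope (parabola_hull S)"
    unfolding parabola_hull_def polytope_def using fin by blast
  note formulations = polytope_has_formulations[OF this ne]
  have "sxc (parabola_hull S) = (LEAST k. has_lmi_formulation (parabola_hull S) k)"
    unfolding sxc_def using ne not_single by (simp only: if_False simp_thms)
  then show "has_lmi_formulation (parabola_hull S) (sxc (parabola_hull S))"
    using LeastI_ex[OF formulations(2)] by (simp only:)
  have "xc (parabola_hull S) = (LEAST l. has_linear_formulation (parabola_hull S) l)"
    unfolding xc_def using ne not_single by (simp only: if_False simp_thms)
  then show "has_linear_formulation (parabola_hull S) (xc (parabola_hull S))"
    using LeastI_ex[OF formulations(1)] by (simp only:)
qed

text \<open>All formulations are padded to the maximal size \<open>K\<close>; the full pattern has
  \<open>K\<^sup>2\<close> entries, whence the fourth power.\<close>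

lemma max_sxc_bound:
  assumes n: "2 \<le> n"
  shows "n \<le> 36 * (Max (sxc ` grid_polygons n)) ^ 4"
proof -
  define K where "K = Max (sxc ` grid_polygons n)"
  have data: "\<exists>A. lmi_data K ({..<K} \<times> {..<K}) parabola_point S (parabola_hull S) A"
    if S: "S \<in> index_sets n" for S
  proof (rule lmi_formulation_data)
    show "has_lmi_formulation (parabola_hull S) (sxc (parabola_hull S))"
      using index_setsD(2)[OF S] n by (intro parabola_hull_sizes) simp
    show "sxc (parabola_hull S) \<le> K"
      unfolding K_def using finite_grid_polygons parabola_hull_in_grid_polygons[OF S] by simp
    show "\<forall>i\<in>S. parabola_point i \<in> parabola_hull S" using parabola_point_in_hull by blast
  qed
  obtain A where "lmi_data K ({..<K} \<times> {..<K}) parabola_point {1..n} (parabola_hull {1..n}) A"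
    using data[OF index_set_exists] by blast
  then have K1: "1 \<le> K" by (rule lmi_data_size_pos) (use n in simp)
  have "n \<le> 36 * (card ({..<K} \<times> {..<K}))\<^sup>2"
    using K1 n by (intro pattern_size_lower_bound[OF data _ pattern_stable_full]) auto
  also have "card ({..<K} \<times> {..<K}) = K\<^sup>2"
    by (simp add: card_cartesian_product power2_eq_square)
  also have "(K\<^sup>2)\<^sup>2 = K ^ 4" by simp
  finally show ?thesis unfolding K_def .
qed

text \<open>The diagonal pattern has only \<open>K\<close> entries, whence the square.\<close>

lemma max_xc_bound:
  assumes n: "2 \<le> n"
  shows "n \<le> 36 * (Max (xc ` grid_polygons n))\<^sup>2"
proof -
  define K where "K = Max (xc ` grid_polygons n)"
  let ?E = "(\<lambda>a. (a, a)) ` {..<K}"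
  have data: "\<exists>A. lmi_data K ?E parabola_point S (parabola_hull S) A"
    if S: "S \<in> index_sets n" for S
  proof (rule linear_formulation_data)
    show "has_linear_formulation (parabola_hull S) (xc (parabola_hull S))"
      using index_setsD(2)[OF S] n by (intro parabola_hull_sizes) simp
    show "xc (parabola_hull S) \<le> K"
      unfolding K_def using finite_grid_polygons parabola_hull_in_grid_polygons[OF S] by simp
    show "\<forall>i\<in>S. parabola_point i \<in> parabola_hull S" using parabola_point_in_hull by blast
  qed
  obtain A where "lmi_data K ?E parabola_point {1..n} (parabola_hull {1..n}) A"
    using data[OF index_set_exists] by blast
  then have K1: "1 \<le> K" by (rule lmi_data_size_pos) (use n in simp)
  have card: "card ?E = K" by (subst card_image) (auto simp: inj_on_def)
  have "n \<le> 36 * (card ?E)\<^sup>2"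
    using K1 n by (intro pattern_size_lower_bound[OF data _ pattern_stable_diagonal]) (auto simp: card)
  then show ?thesis unfolding card unfolding K_def .
qed

theorem corollary9:
  fixes n :: nat
  assumes "n \<ge> 2"
  shows "real (Max (sxc ` grid_polygons n)) \<ge> 1 / 4 * root 4 (real n) \<and>
         real (Max (xc ` grid_polygons n)) \<ge> 1 / 15 * sqrt (real n)"
proof
  define K where "K = Max (sxc ` grid_polygons n)"
  have "n \<le> 36 * K ^ 4" unfolding K_def by (rule max_sxc_bound[OF assms])
  \<comment> \<open>Here 36 is at most 4 ^ 4 = 256.\<close>
  also have "\<dots> \<le> (4 * K) ^ 4" by (simp add: power_mult_distrib)
  finally have "real n \<le> real ((4 * K) ^ 4)" by (simp only: of_nat_le_iff)
  then have "root 4 (real n) \<le> root 4 ((4 * real K) ^ 4)" by (intro real_root_le_mono) simp_all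
  also have "\<dots> = 4 * real K" by (rule real_root_power_cancel) simp_all
  finally show "real (Max (sxc ` grid_polygons n)) \<ge> 1 / 4 * root 4 (real n)" by (simp add: K_def)
next
  define K where "K = Max (xc ` grid_polygons n)"
  have "n \<le> 36 * K\<^sup>2" unfolding K_def by (rule max_xc_bound[OF assms])
  \<comment> \<open>Here 36 is at most 15 * 15 = 225.\<close>
  also have "\<dots> \<le> (15 * K)\<^sup>2" by (simp add: power_mult_distrib)
  finally have "real n \<le> real ((15 * K)\<^sup>2)" by (simp only: of_nat_le_iff)
  then have "sqrt (real n) \<le> sqrt ((15 * real K)\<^sup>2)" by (intro real_sqrt_le_mono) simp
  also have "\<dots> = 15 * real K" by (subst real_sqrt_abs) simp
  finally show "real (Max (xc ` grid_polygons n)) \<ge> 1 / 15 * sqrt (real n)" by (simp add: K_def)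
qed

end
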